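(* Consider the infinite horizon discounted Markov control model with total variation ambiguity of radius $R\in[0,2]$ described in the context, with state space $\mathcal{X}$, nominal kernel $Q^o(dz|x,u)$, cost $f$ bounded, continuous and non-negative, and discount factor $\alpha\in(0,1)$. Let $v_\infty:\mathcal{X}\to\mathbb{R}$ denote the solution of the dynamic programming equation in (1) below. Assume that $v_\infty$ is bounded, continuous and non-negative and that $\sup_{z\in\mathcal{X}}v_\infty(z)$ and $\inf_{z\in\mathcal{X}}v_\infty(z)$ are finite. Then: (1) The dynamic programming equation $$v_\infty(x)=\inf_{u\in\mathcal{U}(x)}\Big\{f(x,u)+\alpha\int_{\mathcal{X}}v_\infty(z)\,Q^o(dz|x,u)+\alpha\frac{R}{2}\Big(\sup_{z\in\mathcal{X}}v_\infty(z)-\inf_{z\in\mathcal{X}}v_\infty(z)\Big)\Big\}$$ has a unique solution. (2) Moreover, $$v_\infty(x)=\inf_{g}\ \mathbb{E}_{Q^*}\Big\{\sum_{j=0}^\infty\alpha^jf(x_j,u_j)\,\Big|\,x_0=x\Big\},$$ where the infimum is over control strategies $g$ and $Q^*$ is the maximizing conditional distribution given in the context. (3) The mapping $T:L\to L$ defined by $$(TV)(x)=\inf_{u\in\mathcal{U}(x)}\Big\{f(x,u)+\alpha\int_{\mathcal{X}}V(z)\,Q^o(dz|x,u)+\alpha\frac{R}{2}\Big(\sup_{z\in\mathcal{X}}V(z)-\inf_{z\in\mathcal{X}}V(z)\Big)\Big\}$$ is a contraction mapping with respect to the norm $\|V\|=\max_{x\in\mathcal{X}}|V(x)|$, where $L$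 is the class of all measurable functions $V:\mathcal{X}\to\mathbb{R}$ with finite norm $\|V\|$. (4) For any $V$ (in $L$), $\lim_{n\to\infty}\|T^nV-v_\infty\|=0$, and so $\lim_{n\to\infty}(T^nV)(x)=v_\infty(x)$ for all $x\in\mathcal{X}$.
   Context: Setting. $\mathcal{X}$ (state space) and $\mathcal{U}$ (control space) are Polish spaces with Borel $\sigma$-algebras; for each $x\in\mathcal{X}$, $\mathcal{U}(x)\subseteq\mathcal{U}$ is a non-empty measurable set of feasible controls, and $\mathbb{K}=\{(x,u):x\in\mathcal{X},u\in\mathcal{U}(x)\}$ is measurable. $Q^o(\cdot|x,u)$ is a nominal stochastic kernel on $\mathcal{X}$ given $\mathbb{K}$. The one-stage cost $f$ is bounded, continuous and non-negative, and $\alpha\in(0,1)$. Ambiguity. The total variation distance of probability measures $\mu,\nu$ on $\mathcal{X}$ is $\|\mu-\nu\|_{TV}=\sup_P\sum_{F\in P}|\mu(F)-\nu(F)|$, the supremum over finite measurable partitions $P$ of $\mathcal{X}$. The true kernel $Q(\cdot|x,u)$ is only known to satisfy $\|Q(\cdot|x,u)-Q^o(\cdot|x,u)\|_{TV}\le R$ for $(x,u)\in\mathbb{K}$; the controller minimizes the discounted cost while the kernel maximizes it over this ball. Maximizing conditional distribution. With $\mathcal{X}^+=\{x\in\mathcal{X}:v_\infty(x)=\sup_{z\in\mathcal{X}}v_\infty(z)\}$ and $\mathcal{X}^-=\{x\in\mathcal{X}:v_\infty(x)=\inf_{z\in\mathcal{X}}v_\infty(z)\}$, the maximizing conditional distribution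 $Q^*$ is given, for $(x,u)\in\mathbb{K}$, by $$Q^*(\mathcal{X}^+|x,u)=Q^o(\mathcal{X}^+|x,u)+\tfrac R2\in[0,1],\qquad Q^*(\mathcal{X}^-|x,u)=Q^o(\mathcal{X}^-|x,u)-\tfrac R2\in[0,1],$$ $$Q^*(A|x,u)=Q^o(A|x,u)\quad\text{for all measurable }A\subseteq\mathcal{X}\setminus(\mathcal{X}^+\cup\mathcal{X}^-).$$ Strategies. A (deterministic) control strategy is a sequence $g=(g_0,g_1,\dots)$ of measurable maps with $u_j=g_j(x_0,u_0,\dots,x_{j-1},u_{j-1},x_j)\in\mathcal{U}(x_j)$. $\mathbb{E}_{Q^*}$ is expectation for the process in which $u_j$ is chosen by $g$ and $x_{j+1}\sim Q^*(\cdot|x_j,u_j)$.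
   Formalization: (3) is false in general: proved instead are contraction if α(1+R)<1, modulus α between V, W having maximizing distributions, and a contracting iterate always. T: L→L is a premise of (3), (4); (2) assumes that a control strategy exists. *)

theory Defs
  imports "HOL-Probability.Probability"
begin

definition feasible_pairs :: "('x \<Rightarrow> 'u set) \<Rightarrow> ('x \<times> 'u) set" where
  "feasible_pairs U = {(x, u). u \<in> U x}"

definition pair_space :: "('x::polish_space \<Rightarrow> 'u::polish_space set) \<Rightarrow> ('x \<times> 'u) measure" where
  "pair_space U = restrict_space (borel \<Otimes>\<^sub>M borel) (feasible_pairs U)"

definition stochastic_kernel ::
    "('x::polish_space \<Rightarrow> 'u::polish_space set) \<Rightarrow> ('x \<times> 'u \<Rightarrow> 'x measure) \<Rightarrow> bool" where
  "stochastic_kernel U Q \<longleftrightarrow> Q \<in> pair_space U \<rightarrow>\<^sub>M prob_algebra borel"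


text \<open>The class \<open>L\<close> and its norm. The norm is a supremum: a bounded measurable function need not
  attain the maximum of its absolute value.\<close>

definition sup_norm :: "('x \<Rightarrow> real) \<Rightarrow> real" where
  "sup_norm V = (SUP x. \<bar>V x\<bar>)"

definition bounded_measurable :: "('x::polish_space \<Rightarrow> real) set" where
  "bounded_measurable = {V \<in> borel_measurable borel. bdd_above (range (\<lambda>x. \<bar>V x\<bar>))}"

definition contraction_on :: "('x \<Rightarrow> real) set \<Rightarrow> (('x \<Rightarrow> real) \<Rightarrow> 'x \<Rightarrow> real) \<Rightarrow> bool" where
  "contraction_on L F \<longleftrightarrow> F ` L \<subseteq> L \<and>
     (\<exists>c. 0 \<le> c \<and> c < 1 \<and>
       (\<forall>V\<in>L. \<forall>W\<in>L. sup_norm (\<lambda>x. F V x - F W x) \<le> c * sup_norm (\<lambda>x. V x - W x)))"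

text \<open>Two pitfalls of the operator below. It need not preserve Borel measurability, because the infimum
  over an uncountable set of controls is only upper semianalytic in general. And although it is the
  ordinary discounted operator plus a constant function, that constant varies with \<open>V\<close> at a rate of up
  to \<open>\<alpha> * R\<close>, so the operator can expand distances by the factor \<open>\<alpha> * (1 + R)\<close>. The modulus is \<open>\<alpha>\<close> between
  functions for which a maximizing kernel exists, and some iterate is always a contraction.\<close>

definition dp_operator ::
    "('x::polish_space \<Rightarrow> 'u::polish_space set) \<Rightarrow> ('x \<times> 'u \<Rightarrow> 'x measure) \<Rightarrow> ('x \<times> 'u \<Rightarrow> real)
      \<Rightarrow> real \<Rightarrow> real \<Rightarrow> ('x \<Rightarrow> real) \<Rightarrow> 'x \<Rightarrow> real" where
  "dp_operator U Qo f \<alpha> R V x =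
     (INF u\<in>U x. f (x, u) + \<alpha> * (\<integral>z. V z \<partial>Qo (x, u))
        + \<alpha> * (R / 2) * ((SUP z. V z) - (INF z. V z)))"


definition sup_set :: "('x \<Rightarrow> real) \<Rightarrow> 'x set" where
  "sup_set V = {x. V x = (SUP z. V z)}"

definition inf_set :: "('x \<Rightarrow> real) \<Rightarrow> 'x set" where
  "inf_set V = {x. V x = (INF z. V z)}"

text \<open>These conditions fix the mass that \<open>Q\<close> gives to \<open>sup_set V\<close> and to \<open>inf_set V\<close>, but not how
  it is distributed inside these two sets. The two shifted masses lie in the unit interval because
  \<open>Q\<close> is a stochastic kernel.\<close>

definition maximizing_kernel ::
    "('x::polish_space \<Rightarrow> 'u::polish_space set) \<Rightarrow> ('x \<times> 'u \<Rightarrow> 'x measure) \<Rightarrow> real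
      \<Rightarrow> ('x \<Rightarrow> real) \<Rightarrow> ('x \<times> 'u \<Rightarrow> 'x measure) \<Rightarrow> bool" where
  "maximizing_kernel U Qo R V Q \<longleftrightarrow> stochastic_kernel U Q \<and>
     (\<forall>k\<in>feasible_pairs U.
        measure (Q k) (sup_set V) = measure (Qo k) (sup_set V) + R / 2 \<and>
        measure (Q k) (inf_set V) = measure (Qo k) (inf_set V) - R / 2 \<and>
        (\<forall>A\<in>sets borel. A \<subseteq> - (sup_set V \<union> inf_set V) \<longrightarrow>
           measure (Q k) A = measure (Qo k) A))"


text \<open>The argument of \<open>g j\<close> is the feasible history of states and controls before time \<open>j\<close>, an
  element of the \<open>j\<close>-fold product of the feasible pairs, together with the state at time \<open>j\<close>.\<close>

definition strategies ::
    "('x::polish_space \<Rightarrow> 'u::polish_space set) \<Rightarrow> (nat \<Rightarrow> (nat \<Rightarrow> 'x \<times> 'u) \<times> 'x \<Rightarrow> 'u) set" where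
  "strategies U =
     {g. \<forall>j. g j \<in> (\<Pi>\<^sub>M i\<in>{0..<j}. pair_space U) \<Otimes>\<^sub>M borel \<rightarrow>\<^sub>M borel \<and>
         (\<forall>h\<in>space (\<Pi>\<^sub>M i\<in>{0..<j}. pair_space U). \<forall>x. g j (h, x) \<in> U x)}"

text \<open>The set of strategies is empty if the feasible pairs contain no graph of a Borel map, which
  nonemptiness and measurability of the feasible sets do not rule out.\<close>

text \<open>Conditional law of the state-control pair at time \<open>j\<close>, given the pairs at times before \<open>j\<close>.\<close>

definition step_kernel ::
    "('x::polish_space \<Rightarrow> 'u::polish_space set) \<Rightarrow> ('x \<times> 'u \<Rightarrow> 'x measure)
      \<Rightarrow> (nat \<Rightarrow> (nat \<Rightarrow> 'x \<times> 'u) \<times> 'x \<Rightarrow> 'u) \<Rightarrow> 'x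
      \<Rightarrow> nat \<Rightarrow> (nat \<Rightarrow> 'x \<times> 'u) \<Rightarrow> ('x \<times> 'u) measure" where
  "step_kernel U Q g x j h =
     distr (if j = 0 then return borel x else Q (h (j - 1))) (pair_space U) (\<lambda>y. (y, g j (h, y)))"

text \<open>The law on trajectories that the Ionescu-Tulcea theorem gives for these conditional laws.\<close>

definition trajectory_law ::
    "('x::polish_space \<Rightarrow> 'u::polish_space set) \<Rightarrow> ('x \<times> 'u \<Rightarrow> 'x measure)
      \<Rightarrow> (nat \<Rightarrow> (nat \<Rightarrow> 'x \<times> 'u) \<times> 'x \<Rightarrow> 'u) \<Rightarrow> 'x \<Rightarrow> (nat \<Rightarrow> 'x \<times> 'u) measure" where
  "trajectory_law U Q g x =
     projective_family.lim UNIV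
       (Ionescu_Tulcea.CI (step_kernel U Q g x) (\<lambda>_. pair_space U)) (\<lambda>_. pair_space U)"

definition discounted_cost ::
    "('x::polish_space \<Rightarrow> 'u::polish_space set) \<Rightarrow> ('x \<times> 'u \<Rightarrow> 'x measure) \<Rightarrow> ('x \<times> 'u \<Rightarrow> real)
      \<Rightarrow> real \<Rightarrow> (nat \<Rightarrow> (nat \<Rightarrow> 'x \<times> 'u) \<times> 'x \<Rightarrow> 'u) \<Rightarrow> 'x \<Rightarrow> real" where
  "discounted_cost U Q f \<alpha> g x = (\<integral>\<omega>. (\<Sum>j. \<alpha> ^ j * f (\<omega> j)) \<partial>trajectory_law U Q g x)"

end

theory Submission
  imports Defs
begin

text \<open>Write \<open>T V = S V + c V\<close>, where \<open>S\<close> is the ordinary discounted operator of the nominal kernel and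
  \<open>c V\<close> is the number \<open>\<alpha> * (R / 2) * oscillation V\<close>, with \<open>oscillation V = sup V - inf V\<close>. Since \<open>c V\<close> does
  not depend on the state, \<open>T\<close> contracts the oscillation of differences by \<open>\<alpha>\<close>
  (\<open>T_oscillation_contraction\<close>), while \<open>c\<close> adds at most \<open>\<alpha> * (R / 2)\<close> times that oscillation to the norm
  (\<open>T_norm_le\<close>). Hence two fixed points differ by a constant, which must be zero. If \<open>T\<close> preserves
  measurability, the \<open>n\<close>-th iterate has Lipschitz constant at most \<open>2 * (n + 1) * \<alpha> ^ n\<close>
  (\<open>iterate_bound\<close>). This tends to zero and is summable, which gives a contracting iterate, a fixed
  point and convergence of the iterates to it. If two functions have maximizing kernels and \<open>R > 0\<close>, each
  of them attains its supremum and has nominal mass at least \<open>R / 2\<close> where it attains its infimum. The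
  worst-case expectations can then be compared under a single probability measure, which gives the
  modulus \<open>\<alpha>\<close> (\<open>maximizing_kernel_comparison\<close>).

  For the optimal cost under a maximizing kernel \<open>Q\<close>, the integral of \<open>v\<close> under \<open>Q\<close> equals the integral under the
  nominal kernel plus \<open>R / 2 * oscillation v\<close>, so that \<open>v\<close> solves the ordinary discounted equation for
  \<open>Q\<close>. Iterating the inequality \<open>v \<le> f + \<alpha> * (integral of v)\<close> along a trajectory shows that no strategy
  costs less than \<open>v\<close>. For the converse, near-optimal controls have to be chosen measurably. The set of
  near-optimal pairs is Borel with nonempty sections but need not contain a Borel graph; it is enough
  to choose controls for almost every state, first at time 0, then under the law of the state at time 1 that
  results, and so on. The selection theorem needed is \<open>measurable_selection_AE\<close>. Its proof
  represents a Borel set as the projection of a closed set along sequences of naturals, finds by continuity of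
  outer measure a compact set of sequences that still projects onto nearly full measure, and takes
  lexicographic minima there. The existence of some strategy provides controls on the exceptional null sets.\<close>

section \<open>Bounded functions, oscillation and maximizing kernels\<close>

lemma bounded_measurableD:
  assumes "V \<in> bounded_measurable"
  shows "V \<in> borel_measurable borel" "\<bar>V x\<bar> \<le> sup_norm V"
    "bdd_above (range V)" "bdd_below (range V)"
proof -
  show "V \<in> borel_measurable borel" using assms by (simp add: bounded_measurable_def)
  have bdd: "bdd_above (range (\<lambda>x. \<bar>V x\<bar>))" using assms by (simp add: bounded_measurable_def)
  then have le: "\<bar>V x\<bar> \<le> sup_norm V" for x
    unfolding sup_norm_def by (intro cSUP_upper) auto
  then show "\<bar>V x\<bar> \<le> sup_norm V" .
  show "bdd_above (range V)" by (rule bdd_aboveI2[of _ _ "sup_norm V"]) (use le abs_le_D1 in blast)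
  show "bdd_below (range V)" by (rule bdd_belowI2[of _ "- sup_norm V"]) (use le abs_le_D2 minus_le_iff in blast)
qed

lemma bounded_measurableI:
  "V \<in> borel_measurable borel \<Longrightarrow> (\<And>x. \<bar>V x\<bar> \<le> c) \<Longrightarrow> V \<in> bounded_measurable"
  by (auto simp: bounded_measurable_def intro!: bdd_aboveI2)

lemma sup_norm_le: "(\<And>x. \<bar>V x\<bar> \<le> c) \<Longrightarrow> sup_norm V \<le> c"
  unfolding sup_norm_def by (intro cSUP_least) auto

lemma sup_norm_nonneg: "V \<in> bounded_measurable \<Longrightarrow> 0 \<le> sup_norm V"
  using bounded_measurableD(2)[of V undefined] by linarith

lemma bounded_measurable_diff:
  assumes "V \<in> bounded_measurable" "W \<in> bounded_measurable"
  shows "(\<lambda>x. V x - W x) \<in> bounded_measurable"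
proof (rule bounded_measurableI)
  show "(\<lambda>x. V x - W x) \<in> borel_measurable borel"
    using assms bounded_measurableD(1) by (intro borel_measurable_diff) auto
  show "\<bar>V x - W x\<bar> \<le> sup_norm V + sup_norm W" for x
    using bounded_measurableD(2)[OF assms(1), of x] bounded_measurableD(2)[OF assms(2), of x] by linarith
qed

lemma sup_norm_diff_commute: "sup_norm (\<lambda>x. V x - W x) = sup_norm (\<lambda>x. W x - V x)"
  by (simp add: sup_norm_def abs_minus_commute)

text \<open>The diameter of the range. In the operator the radius \<open>R\<close> occurs only as a factor of this
  number, which is unchanged when a constant is added to the function.\<close>

definition oscillation :: "('x \<Rightarrow> real) \<Rightarrow> real" where
  "oscillation V = (SUP z. V z) - (INF z. V z)"

lemma oscillation_ge:
  assumes "V \<in> bounded_measurable"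
  shows "V x - V y \<le> oscillation V"
proof -
  have "V x \<le> (SUP z. V z)" "(INF z. V z) \<le> V y"
    using bounded_measurableD(3,4)[OF assms] by (auto intro: cSUP_upper cINF_lower)
  then show ?thesis by (simp add: oscillation_def)
qed

lemma oscillation_nonneg: "V \<in> bounded_measurable \<Longrightarrow> 0 \<le> oscillation V"
  using oscillation_ge[of V undefined undefined] by simp

lemma oscillation_le:
  assumes "\<And>x y. V x - V y \<le> c"
  shows "oscillation V \<le> c"
proof -
  have "(SUP z. V z) \<le> V y + c" for y
    by (intro cSUP_least) (use assms[of _ y] in \<open>auto simp: algebra_simps\<close>)
  then have "(SUP z. V z) - c \<le> (INF z. V z)"
    by (intro cINF_greatest) (auto simp: algebra_simps)
  then show ?thesis by (simp add: oscillation_def)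
qed

lemma oscillation_le_norm:
  assumes "V \<in> bounded_measurable"
  shows "oscillation V \<le> 2 * sup_norm V"
proof (rule oscillation_le)
  show "V x - V y \<le> 2 * sup_norm V" for x y
    using bounded_measurableD(2)[OF assms, of x] bounded_measurableD(2)[OF assms, of y] by linarith
qed

lemma oscillation_triangle:
  assumes "V \<in> bounded_measurable" "W \<in> bounded_measurable"
  shows "oscillation V - oscillation W \<le> oscillation (\<lambda>x. V x - W x)"
proof -
  have "oscillation V \<le> oscillation W + oscillation (\<lambda>x. V x - W x)"
  proof (rule oscillation_le)
    show "V x - V y \<le> oscillation W + oscillation (\<lambda>x. V x - W x)" for x y
      using oscillation_ge[OF assms(2), of x y]
        oscillation_ge[OF bounded_measurable_diff[OF assms], of x y] by linarith
  qed
  then show ?thesis by simp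
qed

lemma oscillation_diff_commute:
  assumes "V \<in> bounded_measurable" "W \<in> bounded_measurable"
  shows "oscillation (\<lambda>x. V x - W x) = oscillation (\<lambda>x. W x - V x)"
proof -
  have "oscillation (\<lambda>x. V x - W x) \<le> oscillation (\<lambda>x. W x - V x)"
    if "V \<in> bounded_measurable" "W \<in> bounded_measurable" for V W :: "'a \<Rightarrow> real"
  proof (rule oscillation_le)
    show "V x - W x - (V y - W y) \<le> oscillation (\<lambda>x. W x - V x)" for x y
      using oscillation_ge[OF bounded_measurable_diff[OF that(2,1)], of y x] by linarith
  qed
  from this[OF assms] this[OF assms(2,1)] show ?thesis by simp
qed

lemma cINF_le_cINF_add:
  fixes g h :: "'a \<Rightarrow> real"
  assumes "A \<noteq> {}" "bdd_below (g ` A)" "\<And>a. a \<in> A \<Longrightarrow> g a \<le> h a + c"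
  shows "(INF a\<in>A. g a) \<le> (INF a\<in>A. h a) + c"
proof -
  have "(INF a\<in>A. g a) - c \<le> (INF a\<in>A. h a)"
  proof (rule cINF_greatest[OF assms(1)])
    fix a assume "a \<in> A"
    with cINF_lower[OF assms(2) this] assms(3)[OF this] show "(INF a\<in>A. g a) - c \<le> h a" by linarith
  qed
  then show ?thesis by simp
qed

lemma integrable_bounded_measurable:
  assumes "V \<in> bounded_measurable" "prob_space P" "sets P = sets borel"
  shows "integrable P V"
proof -
  interpret prob_space P by fact
  show ?thesis
    using bounded_measurableD(1,2)[OF assms(1)] assms(3)
    by (intro integrable_const_bound[of _ "sup_norm V"]) (auto simp: measurable_cong_sets[OF assms(3) refl])
qed

lemma prob_integral_le:
  assumes "V \<in> bounded_measurable" "prob_space P" "sets P = sets borel" "\<And>z. V z \<le> c"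
  shows "(\<integral>z. V z \<partial>P) \<le> c"
  using prob_space.integral_le_const[OF assms(2) integrable_bounded_measurable[OF assms(1-3)]] assms(4)
  by simp

lemma space_pair_space: "space (pair_space U) = feasible_pairs U"
  by (simp add: pair_space_def space_restrict_space space_pair_measure)

lemma stochastic_kernelD:
  assumes "stochastic_kernel U Q" "k \<in> feasible_pairs U"
  shows "prob_space (Q k)" "sets (Q k) = sets borel"
  using measurable_space[OF assms(1)[unfolded stochastic_kernel_def], of k] assms(2)
  by (simp_all add: space_pair_space space_prob_algebra)

lemma sup_set_sets: "V \<in> bounded_measurable \<Longrightarrow> sup_set V \<in> sets borel"
  unfolding sup_set_def using bounded_measurableD(1)[of V] by measurable

lemma inf_set_sets: "V \<in> bounded_measurable \<Longrightarrow> inf_set V \<in> sets borel"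
  unfolding inf_set_def using bounded_measurableD(1)[of V] by measurable

text \<open>The mass \<open>R / 2\<close> gained by \<open>sup_set V\<close> and lost by \<open>inf_set V\<close> raises the integral of \<open>V\<close> by
  \<open>R / 2 * oscillation V\<close>; how \<open>Q\<close> spreads mass inside these sets is irrelevant because \<open>V\<close> is
  constant on each. If the two sets meet, \<open>V\<close> is constant and its oscillation is zero.\<close>

lemma integral_maximizing_kernel:
  assumes Qo: "stochastic_kernel U Qo" and Q: "maximizing_kernel U Qo R V Q"
    and V: "V \<in> bounded_measurable" and k: "k \<in> feasible_pairs U"
  shows "(\<integral>z. V z \<partial>Q k) = (\<integral>z. V z \<partial>Qo k) + R / 2 * oscillation V"
proof (cases "sup_set V \<inter> inf_set V = {}")
  case True
  have kern: "stochastic_kernel U Q" using Q by (simp add: maximizing_kernel_def)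
  define A B C where "A = sup_set V" and "B = inf_set V" and "C = - (A \<union> B)"
  have sets: "A \<in> sets borel" "B \<in> sets borel" "C \<in> sets borel"
    using sup_set_sets[OF V] inf_set_sets[OF V] by (auto simp: A_def B_def C_def)
  have split: "(\<integral>z. V z \<partial>P) = (SUP z. V z) * measure P A + (INF z. V z) * measure P B
      + (\<integral>z. V z \<partial>restrict_space P C)"
    if P: "prob_space P" "sets P = sets borel" for P
  proof -
    interpret prob_space P by fact
    have sp: "space P = UNIV" using sets_eq_imp_space_eq[OF P(2)] by simp
    have s: "A \<in> sets P" "B \<in> sets P" "C \<in> sets P" using sets P(2) by auto
    have "(\<integral>z. V z \<partial>P) = (\<integral>z. (SUP z. V z) * indicator A z + (INF z. V z) * indicator B z
        + indicator C z * V z \<partial>P)"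
    proof (rule Bochner_Integration.integral_cong[OF refl])
      fix z
      show "V z = (SUP z. V z) * indicator A z + (INF z. V z) * indicator B z + indicator C z * V z"
        using True by (auto simp: A_def B_def C_def sup_set_def inf_set_def indicator_def)
    qed
    also have "\<dots> = (SUP z. V z) * measure P A + (INF z. V z) * measure P B + (\<integral>z. indicator C z * V z \<partial>P)"
      using s integrable_bounded_measurable[OF V P] by (simp add: integrable_mult_indicator[where 'b=real, simplified] sp emeasure_eq_measure)
    also have "(\<integral>z. indicator C z * V z \<partial>P) = (\<integral>z. V z \<partial>restrict_space P C)"
      using s by (simp add: integral_restrict_space sp)
    finally show ?thesis .
  qed
  have eq: "restrict_space (Q k) C = restrict_space (Qo k) C"
  proof (rule measure_eqI)
    show "sets (restrict_space (Q k) C) = sets (restrict_space (Qo k) C)"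
      using stochastic_kernelD(2)[OF kern k] stochastic_kernelD(2)[OF Qo k]
      by (simp add: sets_restrict_space)
    fix X assume "X \<in> sets (restrict_space (Q k) C)"
    then have X: "X \<subseteq> C" "X \<in> sets borel"
      using sets by (auto simp: sets_restrict_space stochastic_kernelD(2)[OF kern k])
    have "measure (Q k) X = measure (Qo k) X"
      using Q k X by (auto simp: maximizing_kernel_def A_def B_def C_def)
    then have "emeasure (Q k) X = emeasure (Qo k) X"
      using stochastic_kernelD(1)[OF kern k] stochastic_kernelD(1)[OF Qo k]
      by (simp add: finite_measure.emeasure_eq_measure prob_space_def)
    then show "emeasure (restrict_space (Q k) C) X = emeasure (restrict_space (Qo k) C) X"
      using X sets stochastic_kernelD(2)[OF kern k] stochastic_kernelD(2)[OF Qo k]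
      by (simp add: emeasure_restrict_space)
  qed
  have mass: "measure (Q k) A = measure (Qo k) A + R / 2" "measure (Q k) B = measure (Qo k) B - R / 2"
    using Q k by (auto simp: maximizing_kernel_def A_def B_def)
  then show ?thesis
    unfolding split[OF stochastic_kernelD[OF kern k]] split[OF stochastic_kernelD[OF Qo k]] eq mass
    by (simp add: oscillation_def field_simps)
next
  case False
  have kern: "stochastic_kernel U Q" using Q by (simp add: maximizing_kernel_def)
  from False obtain z where "V z = (SUP z. V z)" "V z = (INF z. V z)"
    by (auto simp: sup_set_def inf_set_def)
  then have eq: "(SUP z. V z) = (INF z. V z)" by simp
  have "V y = (SUP z. V z)" for y
    using cSUP_upper[OF _ bounded_measurableD(3)[OF V], of y]
      cINF_lower[OF bounded_measurableD(4)[OF V], of y] eq by simp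
  then have "V = (\<lambda>_. SUP z. V z)" by blast
  then obtain c where "V = (\<lambda>_. c)" by blast
  then show ?thesis
    using prob_space.prob_space[OF stochastic_kernelD(1)[OF kern k]]
      prob_space.prob_space[OF stochastic_kernelD(1)[OF Qo k]]
    by (simp add: oscillation_def)
qed

section \<open>The dynamic programming operator\<close>

text \<open>Costs need not be measurable or bounded above here: for bounded \<open>V\<close>, nonnegative costs suffice
  for the infimum in \<open>T V\<close> to be one over numbers bounded below.\<close>

locale control_model =
  fixes U :: "'x::polish_space \<Rightarrow> 'u::polish_space set"
    and Qo :: "'x \<times> 'u \<Rightarrow> 'x measure" and f :: "'x \<times> 'u \<Rightarrow> real" and \<alpha> R :: real
  assumes nonempty: "\<And>x. U x \<noteq> {}"
    and nominal: "stochastic_kernel U Qo"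
    and cost_nonneg: "\<And>k. k \<in> feasible_pairs U \<Longrightarrow> 0 \<le> f k"
    and discount: "0 < \<alpha>" "\<alpha> < 1"
    and radius: "0 \<le> R" "R \<le> 2"
begin

abbreviation T :: "('x \<Rightarrow> real) \<Rightarrow> 'x \<Rightarrow> real" where
  "T \<equiv> dp_operator U Qo f \<alpha> R"

lemma T_eq: "T V x = (INF u\<in>U x. f (x, u) + \<alpha> * (\<integral>z. V z \<partial>Qo (x, u)) + \<alpha> * (R / 2) * oscillation V)"
  by (simp add: dp_operator_def oscillation_def)

lemma T_bdd_below:
  assumes "V \<in> bounded_measurable"
  shows "bdd_below ((\<lambda>u. f (x, u) + \<alpha> * (\<integral>z. V z \<partial>Qo (x, u)) + c) ` U x)"
proof (rule bdd_belowI2)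
  fix u assume "u \<in> U x"
  then have k: "(x, u) \<in> feasible_pairs U" by (simp add: feasible_pairs_def)
  note P = stochastic_kernelD[OF nominal k]
  have "(\<lambda>z. - V z) \<in> bounded_measurable"
    using bounded_measurable_diff[OF bounded_measurableI[of "\<lambda>_. 0" 0] assms] by simp
  from prob_integral_le[OF this P, of "sup_norm V"] bounded_measurableD(2)[OF assms]
  have "- sup_norm V \<le> (\<integral>z. V z \<partial>Qo (x, u))" by (simp add: abs_le_iff)
  then have "\<alpha> * (- sup_norm V) \<le> \<alpha> * (\<integral>z. V z \<partial>Qo (x, u))" 
    using discount by (intro mult_left_mono) auto
  then show "\<alpha> * (- sup_norm V) + c \<le> f (x, u) + \<alpha> * (\<integral>z. V z \<partial>Qo (x, u)) + c"
    using cost_nonneg[OF k] by linarith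
qed

lemma T_le_add:
  assumes VW: "V \<in> bounded_measurable" "W \<in> bounded_measurable"
    and le: "\<And>u. u \<in> U x \<Longrightarrow> (\<integral>z. V z \<partial>Qo (x, u)) + R / 2 * oscillation V
        \<le> (\<integral>z. W z \<partial>Qo (x, u)) + R / 2 * oscillation W + c"
  shows "T V x \<le> T W x + \<alpha> * c"
  unfolding T_eq
proof (rule cINF_le_cINF_add[OF nonempty T_bdd_below[OF VW(1)]])
  fix u assume "u \<in> U x"
  from mult_left_mono[OF le[OF this], of \<alpha>]
  show "f (x, u) + \<alpha> * (\<integral>z. V z \<partial>Qo (x, u)) + \<alpha> * (R / 2) * oscillation V
      \<le> f (x, u) + \<alpha> * (\<integral>z. W z \<partial>Qo (x, u)) + \<alpha> * (R / 2) * oscillation W + \<alpha> * c"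
    using discount by (simp add: algebra_simps)
qed

text \<open>The oscillation terms enter as a difference that does not depend on the state, which is why they
  cancel when \<open>T V - T W\<close> is compared at two states.\<close>

lemma T_diff_le:
  assumes VW: "V \<in> bounded_measurable" "W \<in> bounded_measurable" and le: "\<And>z. V z - W z \<le> c"
  shows "T V x - T W x \<le> \<alpha> * c + \<alpha> * (R / 2) * (oscillation V - oscillation W)"
proof -
  have "T V x \<le> T W x + \<alpha> * (c + R / 2 * (oscillation V - oscillation W))"
  proof (rule T_le_add[OF VW])
    fix u assume "u \<in> U x"
    then have k: "(x, u) \<in> feasible_pairs U" by (simp add: feasible_pairs_def)
    note P = stochastic_kernelD[OF nominal k]
    have "(\<integral>z. V z - W z \<partial>Qo (x, u)) \<le> c"
      by (rule prob_integral_le[OF bounded_measurable_diff[OF VW] P le])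
    then show "(\<integral>z. V z \<partial>Qo (x, u)) + R / 2 * oscillation V
        \<le> (\<integral>z. W z \<partial>Qo (x, u)) + R / 2 * oscillation W + (c + R / 2 * (oscillation V - oscillation W))"
      using integrable_bounded_measurable[OF VW(1) P] integrable_bounded_measurable[OF VW(2) P]
      by (simp add: field_simps)
  qed
  then show ?thesis by (simp add: algebra_simps)
qed

lemma T_oscillation_contraction:
  assumes VW: "V \<in> bounded_measurable" "W \<in> bounded_measurable"
  shows "oscillation (\<lambda>x. T V x - T W x) \<le> \<alpha> * oscillation (\<lambda>x. V x - W x)"
proof (rule oscillation_le)
  fix x y
  let ?D = "\<lambda>x. V x - W x"
  note D = bounded_measurableD(3,4)[OF bounded_measurable_diff[OF VW]]
  have "?D z \<le> (SUP z. ?D z)" "(INF z. ?D z) \<le> ?D z" for z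
    using D by (auto intro: cSUP_upper cINF_lower)
  then have upper: "V z - W z \<le> (SUP z. ?D z)" and lower: "W z - V z \<le> - (INF z. ?D z)" for z
    using le_minus_iff by (fastforce simp: algebra_simps)+
  note T_diff_le[OF VW upper, of x] T_diff_le[OF VW(2,1) lower, of y]
  then show "T V x - T W x - (T V y - T W y) \<le> \<alpha> * oscillation ?D"
    unfolding oscillation_def[of ?D] by (simp add: field_simps)
qed

lemma T_norm_le:
  assumes VW: "V \<in> bounded_measurable" "W \<in> bounded_measurable"
  shows "\<bar>T V x - T W x\<bar> \<le> \<alpha> * sup_norm (\<lambda>x. V x - W x) + \<alpha> * (R / 2) * oscillation (\<lambda>x. V x - W x)"
proof -
  have le: "T V x - T W x \<le> \<alpha> * sup_norm (\<lambda>x. V x - W x) + \<alpha> * (R / 2) * oscillation (\<lambda>x. V x - W x)"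
    if VW: "V \<in> bounded_measurable" "W \<in> bounded_measurable" for V W
  proof -
    have "T V x - T W x \<le> \<alpha> * sup_norm (\<lambda>x. V x - W x) + \<alpha> * (R / 2) * (oscillation V - oscillation W)"
      using bounded_measurableD(2)[OF bounded_measurable_diff[OF VW]]
      by (intro T_diff_le[OF VW]) (simp add: abs_le_iff)
    also have "\<dots> \<le> \<alpha> * sup_norm (\<lambda>x. V x - W x) + \<alpha> * (R / 2) * oscillation (\<lambda>x. V x - W x)"
      using oscillation_triangle[OF VW] discount radius by (intro add_left_mono mult_left_mono) auto
    finally show ?thesis .
  qed
  from le[OF VW] le[OF VW(2,1)] show ?thesis
    by (simp add: sup_norm_diff_commute[of W V] oscillation_diff_commute[OF VW(2,1)] abs_le_iff)
qed

lemma T_lipschitz: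
  assumes VW: "V \<in> bounded_measurable" "W \<in> bounded_measurable"
  shows "\<bar>T V x - T W x\<bar> \<le> \<alpha> * (1 + R) * sup_norm (\<lambda>x. V x - W x)"
proof -
  have "\<alpha> * (R / 2) * oscillation (\<lambda>x. V x - W x) \<le> \<alpha> * (R / 2) * (2 * sup_norm (\<lambda>x. V x - W x))"
    using discount radius by (intro mult_left_mono oscillation_le_norm bounded_measurable_diff VW) auto
  with T_norm_le[OF VW, of x] show ?thesis by (simp add: algebra_simps)
qed

lemma fixed_point_unique:
  assumes v: "v \<in> bounded_measurable" "\<And>x. v x = T v x" and w: "w \<in> bounded_measurable" "\<And>x. w x = T w x"
  shows "v = w"
proof -
  let ?D = "\<lambda>x. v x - w x"
  have D: "?D \<in> bounded_measurable" by (rule bounded_measurable_diff[OF v(1) w(1)])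
  have eq: "(\<lambda>x. T v x - T w x) = ?D" using v(2) w(2) by simp
  have "oscillation ?D \<le> \<alpha> * oscillation ?D"
    using T_oscillation_contraction[OF v(1) w(1)] by (simp add: eq)
  then have "(1 - \<alpha>) * oscillation ?D \<le> 0" by (simp add: algebra_simps)
  then have osc: "oscillation ?D = 0"
    using discount oscillation_nonneg[OF D] by (simp add: mult_le_0_iff)
  have "sup_norm ?D \<le> \<alpha> * sup_norm ?D"
    using T_norm_le[OF v(1) w(1)] osc v(2) w(2) by (intro sup_norm_le) simp
  then have "(1 - \<alpha>) * sup_norm ?D \<le> 0" by (simp add: algebra_simps)
  then have "sup_norm ?D \<le> 0" using discount by (simp add: mult_le_0_iff)
  then have "\<bar>?D x\<bar> \<le> 0" for x using bounded_measurableD(2)[OF D, of x] by linarith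
  then show ?thesis by (intro ext) simp
qed

text \<open>The left side is the integral of \<open>W\<close> under the law obtained from \<open>Qo k\<close> by removing mass \<open>R / 2\<close>
  from \<open>inf_set W\<close> and adding it at a maximizer \<open>a\<close> of \<open>W\<close>; the same law tested against \<open>V\<close> cannot exceed
  the right side without \<open>c\<close>. For \<open>R > 0\<close>, the given \<open>Q\<close> serves only to show that a maximizer exists and that
  \<open>inf_set W\<close> has enough nominal mass: \<open>Q\<close> itself may redistribute mass inside \<open>sup_set W\<close> and \<open>inf_set W\<close>,
  and so need not be near \<open>Qo\<close> in total variation.\<close>

lemma maximizing_kernel_comparison:
  assumes Q: "maximizing_kernel U Qo R W Q" and k: "k \<in> feasible_pairs U"
    and VW: "V \<in> bounded_measurable" "W \<in> bounded_measurable" and le: "\<And>z. W z - V z \<le> c"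
  shows "(\<integral>z. W z \<partial>Qo k) + R / 2 * oscillation W \<le> (\<integral>z. V z \<partial>Qo k) + R / 2 * oscillation V + c"
proof -
  note P = stochastic_kernelD[OF nominal k]
  interpret prob_space "Qo k" by (rule P(1))
  have sp: "space (Qo k) = UNIV" using sets_eq_imp_space_eq[OF P(2)] by simp
  let ?D = "\<lambda>z. W z - V z"
  let ?t = "oscillation W - oscillation V"
  have D: "?D \<in> bounded_measurable" by (rule bounded_measurable_diff[OF VW(2,1)])
  have int: "(\<integral>z. ?D z \<partial>Qo k) = (\<integral>z. W z \<partial>Qo k) - (\<integral>z. V z \<partial>Qo k)"
    using integrable_bounded_measurable[OF VW(1) P] integrable_bounded_measurable[OF VW(2) P] by simp
  have "(\<integral>z. ?D z \<partial>Qo k) + R / 2 * ?t \<le> c"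
  proof (cases "R = 0 \<or> ?t \<le> 0")
    case True
    then have "R / 2 * ?t \<le> 0" using radius by (auto simp: mult_le_0_iff)
    moreover have "(\<integral>z. ?D z \<partial>Qo k) \<le> c" by (rule prob_integral_le[OF D P le])
    ultimately show ?thesis by linarith
  next
    case False
    then have R: "0 < R" and t: "0 < ?t" using radius by auto
    have "measure (Q k) (sup_set W) = measure (Qo k) (sup_set W) + R / 2"
      "measure (Q k) (inf_set W) = measure (Qo k) (inf_set W) - R / 2"
      using Q k by (auto simp: maximizing_kernel_def)
    with R measure_nonneg[of "Qo k" "sup_set W"] measure_nonneg[of "Q k" "inf_set W"]
    have "measure (Q k) (sup_set W) \<noteq> 0" and B: "R / 2 \<le> measure (Qo k) (inf_set W)"
      by linarith+
    then have "sup_set W \<noteq> {}" by force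
    then obtain a where a: "W a = (SUP z. W z)" by (auto simp: sup_set_def)
    \<comment> \<open>On \<open>inf_set W\<close> the oscillation of \<open>W\<close> is \<open>W a - W z\<close>, while that of \<open>V\<close> is at least \<open>V a - V z\<close>.\<close>
    have DB: "?D z \<le> c - ?t * indicator (inf_set W) z" for z
    proof (cases "z \<in> inf_set W")
      case True
      then have "oscillation W = W a - W z" using a by (simp add: inf_set_def oscillation_def)
      with oscillation_ge[OF VW(1), of a z] le[of a] True show ?thesis by simp
    qed (use le in simp)
    have "(\<integral>z. ?D z \<partial>Qo k) \<le> (\<integral>z. c - ?t * indicator (inf_set W) z \<partial>Qo k)"
      using inf_set_sets[OF VW(2)] P(2)
      by (intro integral_mono integrable_bounded_measurable[OF D P] DB) (auto simp: emeasure_eq_measure)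
    also have "\<dots> = c - ?t * measure (Qo k) (inf_set W)"
      using inf_set_sets[OF VW(2)] P(2) by (simp add: emeasure_eq_measure sp prob_space[unfolded sp])
    also have "\<dots> \<le> c - ?t * (R / 2)" using mult_left_mono[OF B, of ?t] t by linarith
    finally show ?thesis by (simp add: algebra_simps)
  qed
  then show ?thesis unfolding int by (simp add: field_simps)
qed

lemma T_contraction_of_maximizing_kernels:
  assumes VW: "V \<in> bounded_measurable" "W \<in> bounded_measurable"
    and Q: "maximizing_kernel U Qo R V Q" "maximizing_kernel U Qo R W Q'"
  shows "sup_norm (\<lambda>x. T V x - T W x) \<le> \<alpha> * sup_norm (\<lambda>x. V x - W x)"
proof (rule sup_norm_le)
  fix x
  have le: "T W x \<le> T V x + \<alpha> * sup_norm (\<lambda>x. V x - W x)"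
    if VW: "V \<in> bounded_measurable" "W \<in> bounded_measurable" and Q: "maximizing_kernel U Qo R W Q" for V W Q
  proof (rule T_le_add[OF VW(2,1)])
    fix u assume "u \<in> U x"
    then have k: "(x, u) \<in> feasible_pairs U" by (simp add: feasible_pairs_def)
    have "W z - V z \<le> sup_norm (\<lambda>x. V x - W x)" for z
      using bounded_measurableD(2)[OF bounded_measurable_diff[OF VW], of z] by (simp add: abs_le_iff)
    from maximizing_kernel_comparison[OF Q k VW this]
    show "(\<integral>z. W z \<partial>Qo (x, u)) + R / 2 * oscillation W
      \<le> (\<integral>z. V z \<partial>Qo (x, u)) + R / 2 * oscillation V + sup_norm (\<lambda>x. V x - W x)" .
  qed
  from le[OF VW Q(2)] le[OF VW(2,1) Q(1)]
  show "\<bar>T V x - T W x\<bar> \<le> \<alpha> * sup_norm (\<lambda>x. V x - W x)"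
    by (simp add: sup_norm_diff_commute[of W V] abs_le_iff)
qed

text \<open>The oscillation of the difference shrinks by \<open>\<alpha>\<close> at every step and feeds the norm once per step, so
  the norm is of order \<open>n * \<alpha> ^ n\<close>. The constant uses \<open>R \<le> 2\<close>.\<close>

lemma iterate_bound:
  assumes inv: "T ` bounded_measurable \<subseteq> bounded_measurable"
    and VW: "V \<in> bounded_measurable" "W \<in> bounded_measurable"
  shows "sup_norm (\<lambda>x. (T ^^ n) V x - (T ^^ n) W x) \<le> 2 * (real (Suc n) * \<alpha> ^ n) * sup_norm (\<lambda>x. V x - W x)"
proof -
  let ?D = "\<lambda>n x. (T ^^ n) V x - (T ^^ n) W x"
  have L: "(T ^^ n) V \<in> bounded_measurable" "(T ^^ n) W \<in> bounded_measurable" for n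
    using inv VW by (induction n) auto
  have osc: "oscillation (?D n) \<le> \<alpha> ^ n * oscillation (?D 0)" for n
  proof (induction n)
    case (Suc n)
    have "oscillation (?D (Suc n)) \<le> \<alpha> * oscillation (?D n)"
      using T_oscillation_contraction[OF L] by simp
    also have "\<dots> \<le> \<alpha> * (\<alpha> ^ n * oscillation (?D 0))" using Suc discount by (intro mult_left_mono) auto
    finally show ?case by simp
  qed simp
  have "sup_norm (?D n) \<le> \<alpha> ^ n * sup_norm (?D 0) + real n * \<alpha> ^ n * (R / 2) * oscillation (?D 0)"
  proof (induction n)
    case (Suc n)
    have "sup_norm (?D (Suc n)) \<le> \<alpha> * sup_norm (?D n) + \<alpha> * (R / 2) * oscillation (?D n)"
      using T_norm_le[OF L] by (intro sup_norm_le) simp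
    also have "\<dots> \<le> \<alpha> * (\<alpha> ^ n * sup_norm (?D 0) + real n * \<alpha> ^ n * (R / 2) * oscillation (?D 0))
        + \<alpha> * (R / 2) * (\<alpha> ^ n * oscillation (?D 0))"
      using Suc osc[of n] discount radius by (intro add_mono mult_left_mono) auto
    finally show ?case by (simp add: algebra_simps)
  qed simp
  also have "\<dots> \<le> \<alpha> ^ n * sup_norm (?D 0) + real n * \<alpha> ^ n * (2 / 2) * (2 * sup_norm (?D 0))"
    using discount radius oscillation_nonneg[OF bounded_measurable_diff[OF VW]]
      oscillation_le_norm[OF bounded_measurable_diff[OF VW]]
    by (intro add_left_mono mult_mono) auto
  also have "\<dots> \<le> 2 * (real (Suc n) * \<alpha> ^ n) * sup_norm (?D 0)"
    using discount sup_norm_nonneg[OF bounded_measurable_diff[OF VW]] by (simp add: algebra_simps)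
  finally show ?thesis by simp
qed

lemma summable_iterate_bound: "summable (\<lambda>n. real (Suc n) * \<alpha> ^ n)"
  using geometric_deriv_sums[of \<alpha>] discount by (simp add: sums_iff)

lemma iterate_factor_tendsto: "(\<lambda>n. 2 * (real (Suc n) * \<alpha> ^ n) * c) \<longlonglongrightarrow> 0"
  using tendsto_mult[OF tendsto_mult[OF tendsto_const summable_LIMSEQ_zero[OF summable_iterate_bound]] tendsto_const]
  by simp

text \<open>The iterates of the zero function converge uniformly because their increments are summable.\<close>

lemma fixed_point_exists:
  assumes inv: "T ` bounded_measurable \<subseteq> bounded_measurable"
  shows "\<exists>v \<in> bounded_measurable. \<forall>x. v x = T v x"
proof -
  define V where "V n = (T ^^ n) (\<lambda>_. 0)" for n
  have zero: "(\<lambda>_. 0) \<in> (bounded_measurable :: ('x \<Rightarrow> real) set)" by (rule bounded_measurableI[of _ 0]) auto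
  have L: "V n \<in> bounded_measurable" for n
    unfolding V_def using inv zero by (induction n) auto
  let ?c = "sup_norm (\<lambda>x. T (\<lambda>_. 0) x - 0)"
  have step: "\<bar>V (Suc n) x - V n x\<bar> \<le> 2 * (real (Suc n) * \<alpha> ^ n) * ?c" for n x
  proof -
    have "\<bar>V (Suc n) x - V n x\<bar> \<le> sup_norm (\<lambda>x. V (Suc n) x - V n x)"
      by (rule bounded_measurableD(2)[OF bounded_measurable_diff[OF L L]])
    also have "\<dots> \<le> 2 * (real (Suc n) * \<alpha> ^ n) * ?c"
      using iterate_bound[OF inv _ zero, of "T (\<lambda>_. 0)" n] inv zero
      by (simp add: V_def funpow_swap1 image_subset_iff)
    finally show ?thesis .
  qed
  have "uniform_limit UNIV (\<lambda>n x. \<Sum>i<n. V (Suc i) x - V i x) (\<lambda>x. \<Sum>i. V (Suc i) x - V i x) sequentially"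
    by (rule Weierstrass_m_test[OF _ summable_mult2[OF summable_mult[OF summable_iterate_bound]]])
       (use step in simp)
  moreover have "(\<lambda>n x. \<Sum>i<n. V (Suc i) x - V i x) = V"
    by (intro ext) (subst sum_lessThan_telescope, simp add: V_def)
  ultimately obtain v where v: "uniform_limit UNIV V v sequentially" by auto
  have close: "\<exists>N. \<forall>n\<ge>N. \<forall>x. \<bar>V n x - v x\<bar> < e" if "0 < e" for e
    using uniform_limitD[OF v that] by (simp add: eventually_sequentially dist_real_def)
  have vL: "v \<in> bounded_measurable"
  proof -
    obtain n where n: "\<And>x. \<bar>V n x - v x\<bar> < 1" using close[of 1] by auto
    show ?thesis
    proof (rule bounded_measurableI)
      show "v \<in> borel_measurable borel"
        using bounded_measurableD(1)[OF L] tendsto_uniform_limitI[OF v]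
        by (intro borel_measurable_LIMSEQ_real[of borel V v]) auto
      show "\<bar>v x\<bar> \<le> sup_norm (V n) + 1" for x
        using n[of x] bounded_measurableD(2)[OF L, of n x] by linarith
    qed
  qed
  have "v x = T v x" for x
  proof (rule ccontr)
    assume "v x \<noteq> T v x"
    then have pos: "0 < \<bar>T v x - v x\<bar> / 8" by simp
    from close[OF this] obtain N where N: "\<And>n x'. N \<le> n \<Longrightarrow> \<bar>V n x' - v x'\<bar> < \<bar>T v x - v x\<bar> / 8" by blast
    let ?e = "\<bar>T v x - v x\<bar> / 8"
    have "sup_norm (\<lambda>x. V N x - v x) \<le> ?e"
      by (rule sup_norm_le) (use N[of N] in \<open>simp add: less_imp_le\<close>)
    then have "\<alpha> * (1 + R) * sup_norm (\<lambda>x. V N x - v x) \<le> 1 * (1 + 2) * ?e"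
      using discount radius sup_norm_nonneg[OF bounded_measurable_diff[OF L vL]] by (intro mult_mono) auto
    with T_lipschitz[OF L vL, of N x] have far: "\<bar>V (Suc N) x - T v x\<bar> \<le> 3 * ?e" by (simp add: V_def)
    have near: "\<bar>V (Suc N) x - v x\<bar> \<le> ?e" using N[of "Suc N" x] by simp
    have "\<bar>T v x - v x\<bar> \<le> \<bar>V (Suc N) x - T v x\<bar> + \<bar>V (Suc N) x - v x\<bar>" by linarith
    also have "\<dots> \<le> 3 * ?e + ?e" by (rule add_mono[OF far near])
    finally show False using pos by simp
  qed
  with vL show ?thesis by blast
qed

end

section \<open>Borel sets are analytic\<close>

lemma LIMSEQ_fun_pointwise:
  fixes \<sigma> :: "nat \<Rightarrow> 'i \<Rightarrow> 'b::topological_space"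
  assumes "\<And>i. (\<lambda>k. \<sigma> k i) \<longlonglongrightarrow> \<tau> i"
  shows "\<sigma> \<longlonglongrightarrow> \<tau>"
proof -
  have "limitin (product_topology (\<lambda>i. euclidean) UNIV) \<sigma> \<tau> sequentially"
    using assms by (simp add: limitin_componentwise)
  then show ?thesis by (simp add: euclidean_product_topology)
qed

text \<open>Analytic sets, as projections of closed sets along the Baire space \<open>nat \<Rightarrow> nat\<close> with its product
  topology. Completeness plays no role in the closure properties below, so the ambient space is only
  a metric space.\<close>

definition analytic :: "'a::metric_space set \<Rightarrow> bool" where
  "analytic A \<longleftrightarrow> (\<exists>F::('a \<times> (nat \<Rightarrow> nat)) set. closed F \<and> A = fst ` F)"

lemma analytic_closed: "closed A \<Longrightarrow> analytic A"
  unfolding analytic_def by (intro exI[of _ "A \<times> UNIV"]) (auto intro!: closed_Times image_eqI)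

lemma analytic_UN:
  fixes A :: "nat \<Rightarrow> 'a::metric_space set"
  assumes "\<And>n. analytic (A n)"
  shows "analytic (\<Union>n. A n)"
proof -
  obtain F :: "nat \<Rightarrow> ('a \<times> (nat \<Rightarrow> nat)) set" where F: "\<And>n. closed (F n)" "\<And>n. A n = fst ` F n"
    using assms unfolding analytic_def by metis
  define G where "G = (\<Inter>n. {p. snd p 0 \<noteq> n} \<union> (\<lambda>p. (fst p, \<lambda>i. snd p (Suc i))) -` F n)"
  have "closed {p :: 'a \<times> (nat \<Rightarrow> nat). snd p 0 \<noteq> n}" for n
  proof -
    have "continuous_on UNIV (\<lambda>p :: 'a \<times> (nat \<Rightarrow> nat). snd p 0)"
      by (rule continuous_on_product_then_coordinatewise) (intro continuous_intros)
    then have "closed ((\<lambda>p :: 'a \<times> (nat \<Rightarrow> nat). snd p 0) -` (- {n}))"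
      by (rule closed_vimage[rotated]) (intro closed_Compl Topological_Spaces.open_discrete)
    then show ?thesis by (simp add: vimage_def)
  qed
  moreover have "continuous_on UNIV (\<lambda>p :: 'a \<times> (nat \<Rightarrow> nat). (fst p, \<lambda>i. snd p (Suc i)))"
    by (intro continuous_intros continuous_on_product_then_coordinatewise)
  ultimately have "closed G"
    unfolding G_def using F(1) by (intro closed_INT ballI closed_Un closed_vimage) auto
  moreover have "(\<Union>n. A n) = fst ` G"
  proof (intro set_eqI iffI)
    fix a assume "a \<in> (\<Union>n. A n)"
    then obtain n \<sigma> where "(a, \<sigma>) \<in> F n" using F(2) by force
    \<comment> \<open>The first entry of the sequence selects the member of the union.\<close>
    then have "(a, case_nat n \<sigma>) \<in> G" by (auto simp: G_def)
    then show "a \<in> fst ` G" by force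
  qed (force simp: G_def F(2))
  ultimately show ?thesis unfolding analytic_def by blast
qed

lemma analytic_INT:
  fixes A :: "nat \<Rightarrow> 'a::metric_space set"
  assumes "\<And>n. analytic (A n)"
  shows "analytic (\<Inter>n. A n)"
proof -
  obtain F :: "nat \<Rightarrow> ('a \<times> (nat \<Rightarrow> nat)) set" where F: "\<And>n. closed (F n)" "\<And>n. A n = fst ` F n"
    using assms unfolding analytic_def by metis
  define G where "G = (\<Inter>n. (\<lambda>p. (fst p, \<lambda>i. snd p (prod_encode (n, i)))) -` F n)"
  have "continuous_on UNIV (\<lambda>p :: 'a \<times> (nat \<Rightarrow> nat). (fst p, \<lambda>i. snd p (prod_encode (n, i))))" for n
    by (intro continuous_intros continuous_on_product_then_coordinatewise)
  then have "closed G"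
    unfolding G_def using F(1) by (intro closed_INT ballI closed_vimage) auto
  moreover have "(\<Inter>n. A n) = fst ` G"
  proof (intro set_eqI iffI)
    fix a assume "a \<in> (\<Inter>n. A n)"
    then have "\<forall>n. \<exists>\<sigma>. (a, \<sigma>) \<in> F n" using F(2) by force
    then obtain \<sigma> where \<sigma>: "\<And>n. (a, \<sigma> n) \<in> F n" by metis
    \<comment> \<open>One sequence encodes countably many, through the pairing function.\<close>
    then have "(a, \<lambda>k. case prod_decode k of (n, i) \<Rightarrow> \<sigma> n i) \<in> G" by (auto simp: G_def)
    then show "a \<in> fst ` G" by force
  qed (force simp: G_def F(2))
  ultimately show ?thesis unfolding analytic_def by blast
qed

lemma analytic_open:
  fixes A :: "'a::metric_space set"
  assumes "open A"
  shows "analytic A"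
proof (cases "A = UNIV")
  case True then show ?thesis by (simp add: analytic_closed)
next
  case False
  then have ne: "- A \<noteq> {}" by auto
  define C where "C n = {x. 1 / real (Suc n) \<le> infdist x (- A)}" for n
  have "closed (C n)" for n
    unfolding C_def by (intro closed_Collect_le continuous_intros)
  moreover have "A = (\<Union>n. C n)"
  proof (intro set_eqI iffI)
    fix x assume "x \<in> A"
    then have "infdist x (- A) \<noteq> 0"
      using in_closed_iff_infdist_zero[of "- A" x] assms ne by auto
    then have "0 < infdist x (- A)" using infdist_nonneg[of x "- A"] by linarith
    then obtain n where "1 / real (Suc n) < infdist x (- A)"
      using nat_approx_posE by blast
    then show "x \<in> (\<Union>n. C n)" by (auto simp: C_def intro!: exI[of _ n])
  next
    fix x assume "x \<in> (\<Union>n. C n)"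
    then obtain n where "1 / real (Suc n) \<le> infdist x (- A)" by (auto simp: C_def)
    moreover have "0 < 1 / real (Suc n)" by simp
    ultimately have "infdist x (- A) \<noteq> 0" by linarith
    then show "x \<in> A" by (metis ComplI infdist_zero)
  qed
  ultimately show ?thesis using analytic_UN[of C] analytic_closed by metis
qed

text \<open>Sets that are analytic together with their complement form a sigma-algebra containing the
  closed sets.\<close>

lemma analytic_borel:
  fixes A :: "'a::metric_space set"
  assumes "A \<in> sets borel"
  shows "analytic A"
proof -
  have "A \<in> sigma_sets UNIV (Collect closed)"
    using assms by (simp add: borel_eq_closed)
  then have "analytic A \<and> analytic (- A)"
  proof induction
    case (Basic a)
    then show ?case by (simp add: analytic_closed analytic_open open_Compl)
  next
    case Empty
    then show ?case by (simp add: analytic_closed)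
  next
    case (Compl a)
    then show ?case by (simp add: Compl_eq_Diff_UNIV[symmetric])
  next
    case (Union a)
    then show ?case by (simp add: analytic_UN analytic_INT)
  qed
  then show ?thesis ..
qed

section \<open>Measurable selection almost everywhere\<close>

lemma closed_projection_compact:
  fixes E :: "('a::first_countable_topology \<times> 'b::first_countable_topology) set"
  assumes "closed E" "compact K"
  shows "closed {x. \<exists>y\<in>K. (x, y) \<in> E}"
  unfolding closed_sequential_limits
proof (intro allI impI, elim conjE)
  fix x l assume x: "\<forall>n. x n \<in> {x. \<exists>y\<in>K. (x, y) \<in> E}" and l: "x \<longlonglongrightarrow> l"
  from x obtain y where y: "\<And>n. y n \<in> K" "\<And>n. (x n, y n) \<in> E" by simp metis
  obtain r z where r: "strict_mono r" "z \<in> K" "(y \<circ> r) \<longlonglongrightarrow> z"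
    using compact_imp_seq_compact[OF assms(2)] y(1) unfolding seq_compact_def by metis
  have "(\<lambda>n. ((x \<circ> r) n, (y \<circ> r) n)) \<longlonglongrightarrow> (l, z)"
    using r LIMSEQ_subseq_LIMSEQ[OF l r(1)] by (intro tendsto_Pair)
  with closed_sequentially[OF assms(1), of "\<lambda>n. ((x \<circ> r) n, (y \<circ> r) n)"] y(2)
  have "(l, z) \<in> E" by simp
  with r(2) show "l \<in> {x. \<exists>y\<in>K. (x, y) \<in> E}" by blast
qed

lemma compact_bounded_sequences: "compact {\<sigma> :: nat \<Rightarrow> nat. \<forall>i. \<sigma> i \<le> b i}"
proof -
  have "compactin (product_topology (\<lambda>_. euclidean) UNIV) (Pi\<^sub>E UNIV (\<lambda>i. {..b i}))"
    unfolding compactin_PiE by (simp add: finite_imp_compact)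
  moreover have "Pi\<^sub>E UNIV (\<lambda>i. {..b i}) = {\<sigma> :: nat \<Rightarrow> nat. \<forall>i. \<sigma> i \<le> b i}" by auto
  ultimately show ?thesis by (simp add: euclidean_product_topology)
qed

text \<open>Among the sequences bounded by \<open>b\<close> that the closed relation \<open>E\<close> attaches to a point, the
  lexicographically least one is chosen. It depends measurably on the point because the points admitting
  a bounded sequence with a prescribed finite prefix form a closed set.\<close>

lemma lexicographic_selector:
  fixes E :: "('a::metric_space \<times> (nat \<Rightarrow> nat)) set"
  assumes E: "closed E"
  obtains s :: "'a \<Rightarrow> nat \<Rightarrow> nat" where
    "\<And>i. (\<lambda>x. s x i) \<in> borel \<rightarrow>\<^sub>M count_space UNIV"
    "\<And>x \<sigma>. (x, \<sigma>) \<in> E \<Longrightarrow> (\<And>i. \<sigma> i \<le> b i) \<Longrightarrow> (x, s x) \<in> E"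
proof -
  \<comment> \<open>Points with a bounded sequence in \<open>E\<close> that starts with \<open>t\<close>; \<open>p x k\<close> is the least such prefix of length \<open>k\<close>.\<close>
  define D where "D t = {x. \<exists>\<sigma>. (\<forall>i. \<sigma> i \<le> b i) \<and> (\<forall>i<length t. \<sigma> i = t ! i) \<and> (x, \<sigma>) \<in> E}" for t
  have D_closed: "closed (D t)" for t
  proof -
    define F where "F = E \<inter> (\<Inter>i\<in>{..<length t}. (\<lambda>p. snd p i) -` {t ! i})"
    have "continuous_on UNIV (\<lambda>p :: 'a \<times> (nat \<Rightarrow> nat). snd p i)" for i
      by (rule continuous_on_product_then_coordinatewise) (intro continuous_intros)
    then have "closed F"
      unfolding F_def by (intro closed_Int closed_INT ballI closed_vimage E) auto
    from closed_projection_compact[OF this compact_bounded_sequences[of b]]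
    show ?thesis by (rule back_subst[where P=closed]) (auto simp: D_def F_def)
  qed
  then have D_sets: "D t \<in> sets borel" for t by (rule borel_closed)
  define p where "p x = rec_nat [] (\<lambda>k t. t @ [LEAST m. x \<in> D (t @ [m])])" for x
  have p0: "p x 0 = []" and pS: "p x (Suc k) = p x k @ [LEAST m. x \<in> D (p x k @ [m])]" for x k
    by (simp_all add: p_def)
  have len: "length (p x k) = k" for x k
    by (induction k) (simp_all add: p0 pS)
  have p_meas: "(\<lambda>x. p x k) \<in> borel \<rightarrow>\<^sub>M count_space UNIV" for k
  proof (induction k)
    case 0 then show ?case by (simp add: p0)
  next
    case (Suc k)
    have "(\<lambda>x. t @ [LEAST m. x \<in> D (t @ [m])]) \<in> borel \<rightarrow>\<^sub>M count_space UNIV" for t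
      using D_sets by (intro measurable_compose[OF measurable_Least measurable_count_space]) auto
    from measurable_compose_countable[OF this Suc] show ?case by (simp add: pS)
  qed
  define s where "s x i = p x (Suc i) ! i" for x i
  have nth: "p x k ! i = s x i" if "i < k" for x k i
    using that by (induction k) (auto simp: s_def pS len nth_append less_Suc_eq)
  show thesis
  proof (rule that)
    fix i show "(\<lambda>x. s x i) \<in> borel \<rightarrow>\<^sub>M count_space UNIV"
      unfolding s_def by (rule measurable_compose[OF p_meas measurable_count_space])
  next
    fix x \<sigma> assume x\<sigma>: "(x, \<sigma>) \<in> E" and b: "\<And>i. \<sigma> i \<le> b i"
    have "x \<in> D (p x k)" for k
    proof (induction k)
      case 0 show ?case using x\<sigma> b by (auto simp: D_def p0)
    next
      case (Suc k)
      then obtain \<tau> where \<tau>: "\<forall>i. \<tau> i \<le> b i" "\<forall>i<length (p x k). \<tau> i = p x k ! i" "(x, \<tau>) \<in> E"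
        unfolding D_def by blast
      then have "x \<in> D (p x k @ [\<tau> k])"
        by (auto simp: D_def len nth_append less_Suc_eq intro!: exI[of _ \<tau>])
      then show ?case unfolding pS by (rule LeastI)
    qed
    then have "\<exists>\<tau>. (\<forall>i<k. \<tau> i = s x i) \<and> (x, \<tau>) \<in> E" for k
      using nth[of _ k x] unfolding D_def len mem_Collect_eq by metis
    then obtain \<tau> where \<tau>: "\<And>k i. i < k \<Longrightarrow> \<tau> k i = s x i" "\<And>k. (x, \<tau> k) \<in> E" by metis
    have "(\<lambda>k. \<tau> k i) \<longlonglongrightarrow> s x i" for i
      by (rule tendsto_eventually) (auto intro!: eventually_sequentiallyI[of "Suc i"] \<tau>(1))
    then have "(\<lambda>k. (x, \<tau> k)) \<longlonglongrightarrow> (x, s x)"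
      by (intro tendsto_Pair tendsto_const LIMSEQ_fun_pointwise)
    with closed_sequentially[OF E, of "\<lambda>k. (x, \<tau> k)"] \<tau>(2) show "(x, s x) \<in> E" by simp
  qed
qed

text \<open>A closed relation with full projection already projects from a compact set of sequences onto a set
  of measure at least \<open>c\<close>. The bounds \<open>b i\<close> are chosen one after another: bounding one more entry
  exhausts the current set by an increasing union, along which outer measure is continuous, although the
  sets themselves need not be measurable. By compactness the resulting set is the intersection of
  the closures of the sets with finitely many entries bounded.\<close>

lemma bounded_sections_of_large_measure:
  fixes E :: "('a::metric_space \<times> (nat \<Rightarrow> nat)) set" and M :: "'a measure"
  assumes E: "closed E" and full: "\<And>x. \<exists>\<sigma>. (x, \<sigma>) \<in> E"
    and M: "finite_measure M" "sets M = sets borel" and c: "c < emeasure M UNIV"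
  obtains b where "{x. \<exists>\<sigma>. (\<forall>i. \<sigma> i \<le> b i) \<and> (x, \<sigma>) \<in> E} \<in> sets M"
    "c \<le> emeasure M {x. \<exists>\<sigma>. (\<forall>i. \<sigma> i \<le> b i) \<and> (x, \<sigma>) \<in> E}"
proof -
  interpret finite_measure M by fact
  have sp: "space M = UNIV" using M(2) sets_eq_imp_space_eq[OF M(2)] by simp
  define S where "S k b = {x. \<exists>\<sigma>. (\<forall>i<k. \<sigma> i \<le> b i) \<and> (x, \<sigma>) \<in> E}" for k and b :: "nat \<Rightarrow> nat"
  have "\<exists>b. \<forall>k. c < outer_measure_of M {x. \<exists>\<sigma>. (\<forall>i<k. \<sigma> i \<le> b i) \<and> \<sigma> k \<le> b k \<and> (x, \<sigma>) \<in> E}"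
  proof (rule dependent_wellorder_choice)
    fix k b assume IH: "\<And>j. j < k \<Longrightarrow>
      c < outer_measure_of M {x. \<exists>\<sigma>. (\<forall>i<j. \<sigma> i \<le> b i) \<and> \<sigma> j \<le> b j \<and> (x, \<sigma>) \<in> E}"
    have "c < outer_measure_of M (S k b)"
    proof (cases k)
      case 0
      then have "S k b = UNIV" using full by (simp add: S_def)
      then show ?thesis using c by (metis outer_measure_of_eq sp sets.top)
    next
      case (Suc j)
      have "S k b = {x. \<exists>\<sigma>. (\<forall>i<j. \<sigma> i \<le> b i) \<and> \<sigma> j \<le> b j \<and> (x, \<sigma>) \<in> E}"
        unfolding S_def Suc by (auto simp: less_Suc_eq)
      then show ?thesis using IH[of j] Suc by simp
    qed
    also have "S k b = (\<Union>m. {x. \<exists>\<sigma>. (\<forall>i<k. \<sigma> i \<le> b i) \<and> \<sigma> k \<le> m \<and> (x, \<sigma>) \<in> E})"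
      unfolding S_def by blast
    also have "outer_measure_of M \<dots> =
        (SUP m. outer_measure_of M {x. \<exists>\<sigma>. (\<forall>i<k. \<sigma> i \<le> b i) \<and> \<sigma> k \<le> m \<and> (x, \<sigma>) \<in> E})"
      by (rule SUP_outer_measure_of_incseq[symmetric])
         (auto simp: sp incseq_def intro: order_trans)
    finally show "\<exists>m. c < outer_measure_of M {x. \<exists>\<sigma>. (\<forall>i<k. \<sigma> i \<le> b i) \<and> \<sigma> k \<le> m \<and> (x, \<sigma>) \<in> E}"
      by (simp add: less_SUP_iff)
  qed (simp cong: conj_cong)
  then obtain b where b: "\<And>k. c < outer_measure_of M {x. \<exists>\<sigma>. (\<forall>i<k. \<sigma> i \<le> b i) \<and> \<sigma> k \<le> b k \<and> (x, \<sigma>) \<in> E}"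
    by blast
  have S: "c < outer_measure_of M (S k b)" for k
    by (rule less_le_trans[OF b outer_measure_of_mono]) (auto simp: S_def)
  define D where "D = {x. \<exists>\<sigma>. (\<forall>i. \<sigma> i \<le> b i) \<and> (x, \<sigma>) \<in> E}"
  have D: "D = (\<Inter>k. closure (S k b))"
  proof
    show "D \<subseteq> (\<Inter>k. closure (S k b))"
      by (auto simp: D_def S_def intro!: subsetD[OF closure_subset])
    show "(\<Inter>k. closure (S k b)) \<subseteq> D"
    proof
      fix x assume x: "x \<in> (\<Inter>k. closure (S k b))"
      have "\<exists>p. p \<in> E \<and> dist (fst p) x < 1 / real (Suc k) \<and> (\<forall>i<k. snd p i \<le> b i)" for k
      proof -
        have "x \<in> closure (S k b)" "0 < 1 / real (Suc k)" using x by auto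
        then obtain y where "y \<in> S k b" "dist y x < 1 / real (Suc k)"
          unfolding closure_approachable by blast
        then show ?thesis unfolding S_def by force
      qed
      then obtain p where p: "\<And>k. p k \<in> E" "\<And>k. dist (fst (p k)) x < 1 / real (Suc k)"
        "\<And>k i. i < k \<Longrightarrow> snd (p k) i \<le> b i" by metis
      define y \<sigma> where "y k = fst (p k)" and "\<sigma> k = snd (p k)" for k
      then have y: "\<And>k. dist (y k) x < 1 / real (Suc k)"
        and \<sigma>: "\<And>k i. i < k \<Longrightarrow> \<sigma> k i \<le> b i" "\<And>k. (y k, \<sigma> k) \<in> E" using p by simp_all
      have "\<forall>\<^sub>F k in sequentially. dist (y k) x \<le> inverse (real (Suc k))"
        using y by (intro always_eventually allI less_imp_le) (simp add: inverse_eq_divide)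
      then have "(\<lambda>k. dist (y k) x) \<longlonglongrightarrow> 0"
        by (intro tendsto_sandwich[OF _ _ tendsto_const LIMSEQ_inverse_real_of_nat]) simp_all
      then have yx: "y \<longlonglongrightarrow> x" by (rule tendsto_dist_iff[THEN iffD2])
      \<comment> \<open>Truncation moves \<open>\<sigma> k\<close> into the compact set without touching its first \<open>k\<close> entries.\<close>
      define \<tau> where "\<tau> k i = min (\<sigma> k i) (b i)" for k i
      have "\<tau> k \<in> {\<sigma>. \<forall>i. \<sigma> i \<le> b i}" for k by (simp add: \<tau>_def)
      then obtain z r where r: "z \<in> {\<sigma>. \<forall>i. \<sigma> i \<le> b i}" "strict_mono r" "(\<tau> \<circ> r) \<longlonglongrightarrow> z"
        using seq_compactE[OF compact_imp_seq_compact[OF compact_bounded_sequences[of b]], of \<tau>]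
        by blast
      have "(\<sigma> \<circ> r) \<longlonglongrightarrow> z"
      proof (rule LIMSEQ_fun_pointwise)
        fix i
        have "(\<lambda>k. (\<tau> \<circ> r) k i) \<longlonglongrightarrow> z i"
          by (rule continuous_on_tendsto_compose[OF continuous_on_product_coordinates r(3)]) auto
        moreover have "\<forall>\<^sub>F k in sequentially. (\<tau> \<circ> r) k i = (\<sigma> \<circ> r) k i"
        proof (rule eventually_sequentiallyI[of "Suc i"])
          fix k assume "Suc i \<le> k"
          then have "i < r k" using seq_suble[OF r(2), of k] by linarith
          then show "(\<tau> \<circ> r) k i = (\<sigma> \<circ> r) k i" using \<sigma>(1)[of i "r k"] by (simp add: \<tau>_def)
        qed
        ultimately show "(\<lambda>k. (\<sigma> \<circ> r) k i) \<longlonglongrightarrow> z i" by (rule Lim_transform_eventually)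
      qed
      with LIMSEQ_subseq_LIMSEQ[OF yx r(2)]
      have "(\<lambda>k. ((y \<circ> r) k, (\<sigma> \<circ> r) k)) \<longlonglongrightarrow> (x, z)" by (intro tendsto_Pair)
      with closed_sequentially[OF E, of "\<lambda>k. ((y \<circ> r) k, (\<sigma> \<circ> r) k)"] \<sigma>(2)
      have "(x, z) \<in> E" by simp
      with r(1) show "x \<in> D" by (auto simp: D_def)
    qed
  qed
  have cl: "closure (S k b) \<in> sets M" for k by (simp add: M(2))
  have "c \<le> emeasure M D"
  proof -
    have "emeasure M D = (INF k. emeasure M (closure (S k b)))"
      unfolding D
    proof (rule INF_emeasure_decseq[symmetric])
      show "decseq (\<lambda>k. closure (S k b))"
        unfolding decseq_def S_def by (intro allI impI closure_mono) (blast intro: less_le_trans)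
    qed (use cl in auto)
    moreover have "c \<le> emeasure M (closure (S k b))" for k
      using S[of k] outer_measure_of_mono[OF closure_subset, of M "S k b"] cl[of k] by simp
    ultimately show ?thesis by (auto intro!: INF_greatest)
  qed
  moreover have "D \<in> sets M" unfolding D using cl by auto
  ultimately show thesis using that unfolding D_def by blast
qed

lemma dense_sequence:
  obtains d :: "nat \<Rightarrow> 'a::{metric_space, second_countable_topology}"
  where "\<And>y e. 0 < e \<Longrightarrow> \<exists>n. dist y (d n) < e"
proof -
  obtain D :: "'a set" where D: "countable D" "\<And>X. open X \<Longrightarrow> X \<noteq> {} \<Longrightarrow> \<exists>d\<in>D. d \<in> X"
    using countable_dense_setE by metis
  have ne: "D \<noteq> {}" using D(2)[of UNIV] by auto
  show thesis
  proof (rule that)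
    fix y :: 'a and e :: real assume "0 < e"
    then obtain z where "z \<in> D" "z \<in> ball y e" using D(2)[of "ball y e"] by auto
    moreover from this(1) obtain n where "z = from_nat_into D n"
      using from_nat_into_surj[OF D(1)] by metis
    ultimately show "\<exists>n. dist y (from_nat_into D n) < e" by auto
  qed
qed

text \<open>The relation \<open>B\<close> becomes a closed relation \<open>E\<close> between points and sequences: even entries name
  points of a dense sequence that converge to the value at rate \<open>(1 / 2) ^ i\<close>, odd entries witness membership
  in the analytic set \<open>B\<close>.\<close>

lemma measurable_selection_on_large_set:
  fixes B :: "('a::polish_space \<times> 'b::polish_space) set" and M :: "'a measure"
  assumes B: "B \<in> sets borel" and full: "\<And>x. \<exists>y. (x, y) \<in> B"
    and M: "finite_measure M" "sets M = sets borel" and c: "c < emeasure M UNIV"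
  obtains D s where "D \<in> sets borel" "c \<le> emeasure M D" "s \<in> borel_measurable borel"
    "\<And>x. x \<in> D \<Longrightarrow> (x, s x) \<in> B"
proof -
  obtain F :: "(('a \<times> 'b) \<times> (nat \<Rightarrow> nat)) set" where F: "closed F" "B = fst ` F"
    using analytic_borel[OF B] unfolding analytic_def by blast
  obtain d :: "nat \<Rightarrow> 'b" where d: "\<And>y e. 0 < e \<Longrightarrow> \<exists>n. dist y (d n) < e"
    using dense_sequence by blast
  define code where "code y \<sigma> \<longleftrightarrow> (\<forall>i. dist y (d (\<sigma> (2 * i))) \<le> (1 / 2) ^ i)" for y and \<sigma> :: "nat \<Rightarrow> nat"
  define E where "E = {(x, \<sigma>). \<exists>y. code y \<sigma> \<and> ((x, y), \<lambda>i. \<sigma> (2 * i + 1)) \<in> F}"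
  have half: "(\<lambda>i. (1 / 2 :: real) ^ i) \<longlonglongrightarrow> 0" by (rule LIMSEQ_realpow_zero) auto
  have closed_E: "closed E"
    unfolding closed_sequential_limits
  proof (intro allI impI, elim conjE)
    fix p l assume p: "\<forall>n. p n \<in> E" and l: "p \<longlonglongrightarrow> l"
    define x \<sigma> where "x n = fst (p n)" and "\<sigma> n = snd (p n)" for n
    have lx: "x \<longlonglongrightarrow> fst l" unfolding x_def by (intro tendsto_intros l)
    have "\<sigma> \<longlonglongrightarrow> snd l" unfolding \<sigma>_def by (intro tendsto_intros l)
    then have "(\<lambda>n. \<sigma> n i) \<longlonglongrightarrow> snd l i" for i
      by (rule continuous_on_tendsto_compose[OF continuous_on_product_coordinates]) auto
    then have ev: "\<forall>\<^sub>F n in sequentially. \<sigma> n i = snd l i" for i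
      by (simp add: tendsto_discrete)
    have "\<forall>n. \<exists>y. code y (\<sigma> n) \<and> ((x n, y), \<lambda>i. \<sigma> n (2 * i + 1)) \<in> F"
      using p by (simp add: E_def x_def \<sigma>_def case_prod_beta)
    then obtain y where y: "\<And>n. code (y n) (\<sigma> n)" "\<And>n. ((x n, y n), \<lambda>i. \<sigma> n (2 * i + 1)) \<in> F"
      by metis
    have near: "\<forall>\<^sub>F n in sequentially. dist (y n) (d (snd l (2 * i))) \<le> (1 / 2) ^ i" for i
      using ev[of "2 * i"] by eventually_elim (metis code_def y(1))
    have "Cauchy y"
    proof (rule metric_CauchyI)
      fix e :: real assume "0 < e"
      then have "\<forall>\<^sub>F i in sequentially. (1 / 2) ^ i < e / 2"
        by (intro order_tendstoD(2)[OF half]) auto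
      then obtain i :: nat where i: "(1 / 2) ^ i < e / 2"
        unfolding eventually_sequentially by blast
      obtain N where N: "\<And>n. N \<le> n \<Longrightarrow> dist (y n) (d (snd l (2 * i))) \<le> (1 / 2) ^ i"
        using near[of i] unfolding eventually_sequentially by blast
      have "dist (y m) (y n) < e" if "N \<le> m" "N \<le> n" for m n
        using N[OF that(1)] N[OF that(2)] i dist_triangle2[of "y m" "y n" "d (snd l (2 * i))"] by linarith
      then show "\<exists>N. \<forall>m\<ge>N. \<forall>n\<ge>N. dist (y m) (y n) < e" by blast
    qed
    then obtain z where z: "y \<longlonglongrightarrow> z" using Cauchy_convergent convergent_def by blast
    have "code z (snd l)"
      unfolding code_def
    proof
      fix i
      have "(\<lambda>n. dist (y n) (d (snd l (2 * i)))) \<longlonglongrightarrow> dist z (d (snd l (2 * i)))"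
        by (intro tendsto_intros z)
      from tendsto_upperbound[OF this near] show "dist z (d (snd l (2 * i))) \<le> (1 / 2) ^ i" by simp
    qed
    moreover have "((fst l, z), \<lambda>i. snd l (2 * i + 1)) \<in> F"
    proof (rule closed_sequentially[OF F(1)])
      show "((x n, y n), \<lambda>i. \<sigma> n (2 * i + 1)) \<in> F" for n by (rule y(2))
      show "(\<lambda>n. ((x n, y n), \<lambda>i. \<sigma> n (2 * i + 1))) \<longlonglongrightarrow> ((fst l, z), \<lambda>i. snd l (2 * i + 1))"
        by (intro tendsto_Pair lx z LIMSEQ_fun_pointwise tendsto_eventually ev)
    qed
    ultimately show "l \<in> E" by (auto simp: E_def case_prod_beta)
  qed
  have full_E: "\<exists>\<sigma>. (x, \<sigma>) \<in> E" for x
  proof -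
    obtain y \<tau> where y: "((x, y), \<tau>) \<in> F" using full[of x] F(2) by force
    have "\<forall>i. \<exists>n. dist y (d n) \<le> (1 / 2) ^ i" using d[of "(1 / 2) ^ _" y] less_imp_le by (metis zero_less_power half_gt_zero_iff zero_less_one)
    then obtain m where m: "\<And>i. dist y (d (m i)) \<le> (1 / 2) ^ i" by metis
    have "(x, \<lambda>k. if even k then m (k div 2) else \<tau> (k div 2)) \<in> E"
      unfolding E_def code_def using y m by (auto intro!: exI[of _ y])
    then show ?thesis by (rule exI[where P = "\<lambda>\<sigma>. (x, \<sigma>) \<in> E"])
  qed
  obtain b where b:
      "{x. \<exists>\<sigma>. (\<forall>i. \<sigma> i \<le> b i) \<and> (x, \<sigma>) \<in> E} \<in> sets M"
      "c \<le> emeasure M {x. \<exists>\<sigma>. (\<forall>i. \<sigma> i \<le> b i) \<and> (x, \<sigma>) \<in> E}"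
    by (rule bounded_sections_of_large_measure[OF closed_E full_E M c])
  define D where "D = {x. \<exists>\<sigma>. (\<forall>i. \<sigma> i \<le> b i) \<and> (x, \<sigma>) \<in> E}"
  obtain t where t: "\<And>i. (\<lambda>x. t x i) \<in> borel \<rightarrow>\<^sub>M count_space UNIV"
    "\<And>x \<sigma>. (x, \<sigma>) \<in> E \<Longrightarrow> (\<And>i. \<sigma> i \<le> b i) \<Longrightarrow> (x, t x) \<in> E"
    by (rule lexicographic_selector[OF closed_E, where b = b]) blast
  have "\<exists>y. code y (t x) \<and> (x, y) \<in> B" if "x \<in> D" for x
  proof -
    have "(x, t x) \<in> E" using that t(2) by (auto simp: D_def)
    then show ?thesis unfolding E_def F(2) by force
  qed
  then obtain s where s: "\<And>x. x \<in> D \<Longrightarrow> code (s x) (t x)" "\<And>x. x \<in> D \<Longrightarrow> (x, s x) \<in> B"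
    by metis
  have D: "D \<in> sets borel" "c \<le> emeasure M D" using b M(2) by (simp_all add: D_def)
  have "(\<lambda>x. if x \<in> D then s x else d 0) \<in> borel_measurable borel"
  proof (rule borel_measurable_LIMSEQ_metric)
    show "(\<lambda>x. if x \<in> D then d (t x (2 * i)) else d 0) \<in> borel_measurable borel" for i
      using D(1) t(1)[of "2 * i"] by (intro measurable_If_set measurable_compose[OF t(1)]) auto
    show "(\<lambda>i. if x \<in> D then d (t x (2 * i)) else d 0) \<longlonglongrightarrow> (if x \<in> D then s x else d 0)" for x
    proof (cases "x \<in> D")
      case True
      then have le: "dist (d (t x (2 * i))) (s x) \<le> (1 / 2) ^ i" for i
        using s(1) by (simp add: code_def dist_commute)
      have "(\<lambda>i. dist (d (t x (2 * i))) (s x)) \<longlonglongrightarrow> 0"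
        by (rule tendsto_sandwich[OF _ _ tendsto_const half]) (simp_all add: le)
      then have "(\<lambda>i. d (t x (2 * i))) \<longlonglongrightarrow> s x" by (rule tendsto_dist_iff[THEN iffD2])
      then show ?thesis using True by simp
    qed simp
  qed
  with D show thesis
    by (rule that) (simp add: s(2))
qed

text \<open>A measure-theoretic form of the Jankov--von Neumann selection theorem. A Borel selector defined
  everywhere need not exist.\<close>

theorem measurable_selection_AE:
  fixes B :: "('a::polish_space \<times> 'b::polish_space) set" and M :: "'a measure"
  assumes B: "B \<in> sets borel" and full: "\<And>x. \<exists>y. (x, y) \<in> B"
    and M: "finite_measure M" "sets M = sets borel"
  obtains s where "s \<in> borel_measurable borel" "AE x in M. (x, s x) \<in> B"
proof (cases "measure M UNIV = 0")
  interpret finite_measure M by fact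
  have sp: "space M = UNIV" using sets_eq_imp_space_eq[OF M(2)] by simp
  {
    case True
    then have "AE x in M. (x, undefined) \<in> B"
      by (intro AE_I[of _ _ UNIV]) (auto simp: emeasure_eq_measure sp M(2))
    then show thesis using that[of "\<lambda>_. undefined"] by simp
  next
    case False
    then have pos: "0 < measure M UNIV" using measure_nonneg[of M UNIV] by linarith
    have "\<exists>D s. D \<in> sets borel \<and> ennreal (measure M UNIV - 1 / Suc n) \<le> emeasure M D \<and>
        s \<in> borel_measurable borel \<and> (\<forall>x\<in>D. (x, s x) \<in> B)" for n
    proof -
      have "ennreal (measure M UNIV - 1 / Suc n) < emeasure M UNIV"
        using pos by (simp add: emeasure_eq_measure ennreal_lessI)
      from measurable_selection_on_large_set[OF B full M this] show ?thesis by metis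
    qed
    then obtain D s where D: "\<And>n. D n \<in> sets borel"
      and large: "\<And>n. ennreal (measure M UNIV - 1 / Suc n) \<le> emeasure M (D n)"
      and s: "\<And>n. s n \<in> borel_measurable borel" "\<And>n x. x \<in> D n \<Longrightarrow> (x, s n x) \<in> B" by metis
    have "(\<lambda>x. LEAST n. x \<in> D n) \<in> borel \<rightarrow>\<^sub>M count_space UNIV"
      using D by (intro measurable_Least) auto
    from measurable_compose_countable[of s, OF s(1) this]
    have "(\<lambda>x. s (LEAST n. x \<in> D n) x) \<in> borel_measurable borel" .
    moreover have "AE x in M. (x, s (LEAST n. x \<in> D n) x) \<in> B"
    proof (rule AE_I[of _ _ "UNIV - (\<Union>n. D n)"])
      show "{x \<in> space M. (x, s (LEAST n. x \<in> D n) x) \<notin> B} \<subseteq> UNIV - (\<Union>n. D n)"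
        using s(2) by (auto dest: LeastI)
      have U: "(\<Union>n. D n) \<in> sets M" using D M(2) by auto
      have "measure M UNIV - 1 / Suc n \<le> measure M (\<Union>n. D n)" for n
      proof -
        have "measure M UNIV - 1 / Suc n \<le> measure M (D n)"
          using large[of n] by (simp add: emeasure_eq_measure)
        also have "\<dots> \<le> measure M (\<Union>n. D n)"
          using U by (intro finite_measure_mono) auto
        finally show ?thesis .
      qed
      moreover have "(\<lambda>n. measure M UNIV - 1 / Suc n) \<longlonglongrightarrow> measure M UNIV - 0"
        using LIMSEQ_inverse_real_of_nat by (intro tendsto_diff tendsto_const) (simp add: inverse_eq_divide)
      ultimately have "measure M UNIV \<le> measure M (\<Union>n. D n)"
        using LIMSEQ_le_const2[of "\<lambda>n. measure M UNIV - 1 / Suc n"] by auto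
      moreover have "measure M (UNIV - (\<Union>n. D n)) = measure M UNIV - measure M (\<Union>n. D n)"
        using finite_measure_compl[OF U] by (simp add: sp)
      ultimately have "measure M (UNIV - (\<Union>n. D n)) = 0"
        using measure_nonneg[of M "UNIV - (\<Union>n. D n)"] by linarith
      then show "emeasure M (UNIV - (\<Union>n. D n)) = 0" by (simp only: emeasure_eq_measure ennreal_0)
      show "UNIV - (\<Union>n. D n) \<in> sets M" using U sp by (metis sets.compl_sets)
    qed
    ultimately show thesis by (rule that)
  }
qed

section \<open>The controlled process\<close>

text \<open>A process started at \<open>x\<close> whose transitions follow \<open>Q\<close> and whose controls follow the strategy \<open>g\<close>.\<close>

locale controlled_process =
  fixes U :: "'x::polish_space \<Rightarrow> 'u::polish_space set"
    and Q :: "'x \<times> 'u \<Rightarrow> 'x measure" and g :: "nat \<Rightarrow> (nat \<Rightarrow> 'x \<times> 'u) \<times> 'x \<Rightarrow> 'u" and x :: 'x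
  assumes kernel: "stochastic_kernel U Q" and strategy: "g \<in> strategies U"
begin

lemma coordinate_measurable:
  assumes "i \<in> I" "F \<in> pair_space U \<rightarrow>\<^sub>M N"
  shows "(\<lambda>h. F (h i)) \<in> (\<Pi>\<^sub>M i\<in>I. pair_space U) \<rightarrow>\<^sub>M N"
  using measurable_compose[OF measurable_component_singleton[OF assms(1), of "\<lambda>_. pair_space U"] assms(2)] .

lemma strategy_measurable: "g j \<in> (\<Pi>\<^sub>M i\<in>{0..<j}. pair_space U) \<Otimes>\<^sub>M borel \<rightarrow>\<^sub>M borel"
  using strategy by (simp add: strategies_def)

lemma strategy_feasible: "h \<in> space (\<Pi>\<^sub>M i\<in>{0..<j}. pair_space U) \<Longrightarrow> g j (h, y) \<in> U y"
  using strategy by (simp add: strategies_def)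

lemma graph_measurable:
  "(\<lambda>(h, y). (y, g j (h, y))) \<in> (\<Pi>\<^sub>M i\<in>{0..<j}. pair_space U) \<Otimes>\<^sub>M borel \<rightarrow>\<^sub>M pair_space U"
proof -
  have "(\<lambda>p. (snd p, g j p)) \<in> (\<Pi>\<^sub>M i\<in>{0..<j}. pair_space U) \<Otimes>\<^sub>M borel \<rightarrow>\<^sub>M pair_space U"
    unfolding pair_space_def
  proof (rule measurable_restrict_space2)
    show "(\<lambda>p. (snd p, g j p)) \<in> space ((\<Pi>\<^sub>M i\<in>{0..<j}. restrict_space (borel \<Otimes>\<^sub>M borel) (feasible_pairs U)) \<Otimes>\<^sub>M borel)
      \<rightarrow> feasible_pairs U"
      using strategy_feasible[of _ j] by (auto simp: space_pair_measure feasible_pairs_def pair_space_def)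
    show "(\<lambda>p. (snd p, g j p)) \<in> (\<Pi>\<^sub>M i\<in>{0..<j}. restrict_space (borel \<Otimes>\<^sub>M borel) (feasible_pairs U)) \<Otimes>\<^sub>M borel
      \<rightarrow>\<^sub>M borel \<Otimes>\<^sub>M borel"
      using strategy_measurable[of j, unfolded pair_space_def] by (intro measurable_Pair measurable_snd)
  qed
  then show ?thesis by (simp add: case_prod_beta')
qed

lemma state_kernel_measurable:
  fixes j :: nat
  shows "(\<lambda>h. if j = 0 then return borel x else Q (h (j - 1))) \<in> (\<Pi>\<^sub>M i\<in>{0..<j}. pair_space U) \<rightarrow>\<^sub>M prob_algebra borel"
proof (cases j)
  case 0
  have "return borel x \<in> space (prob_algebra borel)"
    by (simp add: space_prob_algebra prob_space_return)
  then show ?thesis using 0 by simp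
next
  case (Suc i)
  have "(\<lambda>h. h i) \<in> (\<Pi>\<^sub>M i\<in>{0..<Suc i}. pair_space U) \<rightarrow>\<^sub>M pair_space U"
    by (rule measurable_component_singleton) simp
  from measurable_compose[OF this kernel[unfolded stochastic_kernel_def]]
  show ?thesis using Suc by simp
qed

lemma step_kernel_measurable:
  "step_kernel U Q g x j \<in> (\<Pi>\<^sub>M i\<in>{0..<j}. pair_space U) \<rightarrow>\<^sub>M prob_algebra (pair_space U)"
  unfolding step_kernel_def[abs_def]
  by (rule measurable_distr_prob_space2[OF state_kernel_measurable graph_measurable])

sublocale IT: Ionescu_Tulcea "step_kernel U Q g x" "\<lambda>_. pair_space U"
proof (rule Ionescu_Tulcea.intro)
  fix i
  show "step_kernel U Q g x i \<in> (\<Pi>\<^sub>M i\<in>{0..<i}. pair_space U) \<rightarrow>\<^sub>M subprob_algebra (pair_space U)"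
    by (rule measurable_prob_algebraD[OF step_kernel_measurable])
  fix h :: "nat \<Rightarrow> 'x \<times> 'u" assume "h \<in> space (\<Pi>\<^sub>M i\<in>{0..<i}. pair_space U)"
  from measurable_space[OF step_kernel_measurable this]
  show "prob_space (step_kernel U Q g x i h)" by (simp add: space_prob_algebra)
qed

text \<open>The law of the state-control pairs at times before \<open>j\<close>; at \<open>j = 0\<close> the only history is the constant
  function \<open>undefined\<close>.\<close>

abbreviation history_law :: "nat \<Rightarrow> (nat \<Rightarrow> 'x \<times> 'u) measure" where
  "history_law j \<equiv> IT.C 0 j (\<lambda>_. undefined)"

lemma sets_history_law: "sets (history_law j) = sets (\<Pi>\<^sub>M i\<in>{0..<j}. pair_space U)"
  using IT.sets_C[of "\<lambda>_. undefined" 0 j] by simp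

lemma space_history_law: "space (history_law j) = space (\<Pi>\<^sub>M i\<in>{0..<j}. pair_space U)"
  by (rule sets_eq_imp_space_eq[OF sets_history_law])

lemma prob_space_history_law: "prob_space (history_law j)"
  using IT.prob_space_C[of "\<lambda>_. undefined" 0 j] by simp

lemma sets_trajectory_law: "sets (trajectory_law U Q g x) = sets (\<Pi>\<^sub>M i\<in>UNIV. pair_space U)"
  unfolding trajectory_law_def by (rule IT.PF.sets_lim)

lemma nn_integral_trajectory_law:
  assumes F: "F \<in> borel_measurable (pair_space U)"
  shows "(\<integral>\<^sup>+\<omega>. F (\<omega> j) \<partial>trajectory_law U Q g x) = (\<integral>\<^sup>+h. F (h j) \<partial>history_law (Suc j))"
proof -
  let ?J = "{0..<Suc j}"
  let ?P = "\<Pi>\<^sub>M i\<in>?J. pair_space U"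
  have Fj: "(\<lambda>h. F (h j)) \<in> borel_measurable ?P"
    by (rule coordinate_measurable[OF _ F]) simp
  have up: "IT.up_to ?J = Suc j"
    by (rule antisym) (simp_all add: IT.up_to_iff Suc_le_eq IT.up_to_less)
  have res: "(\<lambda>h. restrict h ?J) \<in> trajectory_law U Q g x \<rightarrow>\<^sub>M ?P"
    by (subst measurable_cong_sets[OF sets_trajectory_law refl]) (rule measurable_restrict_subset, simp)
  have res': "(\<lambda>h. restrict h ?J) \<in> history_law (Suc j) \<rightarrow>\<^sub>M ?P"
    by (subst measurable_cong_sets[OF sets_history_law refl]) (rule measurable_restrict_subset, simp)
  have "(\<integral>\<^sup>+\<omega>. F (\<omega> j) \<partial>trajectory_law U Q g x) = (\<integral>\<^sup>+h. F (h j) \<partial>distr (trajectory_law U Q g x) ?P (\<lambda>h. restrict h ?J))"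
    using Fj by (subst nn_integral_distr[OF res]) simp_all
  also have "distr (trajectory_law U Q g x) ?P (\<lambda>h. restrict h ?J) = distr (history_law (Suc j)) ?P (\<lambda>h. restrict h ?J)"
    unfolding trajectory_law_def using IT.distr_lim[of ?J] by (simp add: IT.CI_def up)
  also have "(\<integral>\<^sup>+h. F (h j) \<partial>distr (history_law (Suc j)) ?P (\<lambda>h. restrict h ?J)) = (\<integral>\<^sup>+h. F (h j) \<partial>history_law (Suc j))"
    using Fj by (subst nn_integral_distr[OF res']) simp_all
  finally show ?thesis .
qed

lemma nn_integral_step_kernel:
  assumes F: "F \<in> borel_measurable (pair_space U)" and h: "h \<in> space (\<Pi>\<^sub>M i\<in>{0..<j}. pair_space U)"
  shows "(\<integral>\<^sup>+k. F k \<partial>step_kernel U Q g x j h) =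
    (\<integral>\<^sup>+y. F (y, g j (h, y)) \<partial>(if j = 0 then return borel x else Q (h (j - 1))))"
proof -
  let ?\<kappa> = "if j = 0 then return borel x else Q (h (j - 1))"
  have sets: "sets ?\<kappa> = sets borel"
    using measurable_space[OF state_kernel_measurable h] by (auto simp: space_prob_algebra)
  have "(\<lambda>y. (y, g j (h, y))) \<in> ?\<kappa> \<rightarrow>\<^sub>M pair_space U"
    unfolding measurable_cong_sets[OF sets refl]
    using measurable_Pair2[OF graph_measurable h] by simp
  then show ?thesis unfolding step_kernel_def by (rule nn_integral_distr) (simp add: F)
qed

lemma nn_integral_history_law_Suc:
  assumes F: "F \<in> borel_measurable (pair_space U)"
  shows "(\<integral>\<^sup>+h. F (h j) \<partial>history_law (Suc j)) = (\<integral>\<^sup>+h. \<integral>\<^sup>+k. F k \<partial>step_kernel U Q g x j h \<partial>history_law j)"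
proof -
  have Fj: "(\<lambda>h. F (h j)) \<in> borel_measurable (\<Pi>\<^sub>M i\<in>{0..<Suc j}. pair_space U)"
    by (rule coordinate_measurable[OF _ F]) simp
  have "IT.eP j \<in> history_law j \<rightarrow>\<^sub>M subprob_algebra (\<Pi>\<^sub>M i\<in>{0..<Suc j}. pair_space U)"
    by (subst measurable_cong_sets[OF sets_history_law refl]) (rule IT.measurable_eP)
  then have "(\<integral>\<^sup>+h. F (h j) \<partial>history_law (Suc j)) = (\<integral>\<^sup>+h. \<integral>\<^sup>+h'. F (h' j) \<partial>IT.eP j h \<partial>history_law j)"
    using nn_integral_bind[OF Fj, of "IT.eP j" "history_law j"] by simp
  also have "\<dots> = (\<integral>\<^sup>+h. \<integral>\<^sup>+k. F k \<partial>step_kernel U Q g x j h \<partial>history_law j)"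
    by (intro nn_integral_cong) (simp add: IT.nn_integral_eP Fj space_history_law)
  finally show ?thesis .
qed

lemma nn_integral_trajectory_0:
  assumes F: "F \<in> borel_measurable (pair_space U)"
  shows "(\<integral>\<^sup>+\<omega>. F (\<omega> 0) \<partial>trajectory_law U Q g x) = F (x, g 0 (\<lambda>_. undefined, x))"
proof -
  have h: "(\<lambda>_. undefined) \<in> space (\<Pi>\<^sub>M i\<in>{0..<0::nat}. pair_space U)" by (simp add: space_PiM)
  have "(\<lambda>y. F (y, g 0 (\<lambda>_. undefined, y))) \<in> borel_measurable borel"
    using measurable_compose[OF measurable_Pair2[OF graph_measurable h] F] by simp
  moreover have "(\<lambda>h. \<integral>\<^sup>+k. F k \<partial>step_kernel U Q g x 0 h) \<in> borel_measurable (\<Pi>\<^sub>M i\<in>{0..<0::nat}. pair_space U)"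
    by (rule measurable_compose[OF IT.P nn_integral_measurable_subprob_algebra[OF F]])
  ultimately show ?thesis
    unfolding nn_integral_trajectory_law[OF F] nn_integral_history_law_Suc[OF F]
    using h nn_integral_step_kernel[OF F h] by (simp add: nn_integral_return)
qed

text \<open>The Markov property for integrands that, under \<open>g\<close>, see only the next state. This covers functions
  of the state under any strategy, and all functions under a strategy that ignores the past.\<close>

lemma nn_integral_trajectory_Suc:
  assumes F: "F \<in> borel_measurable (pair_space U)" and V: "V \<in> borel_measurable borel"
    and FV: "\<And>h y. h \<in> space (\<Pi>\<^sub>M i\<in>{0..<Suc j}. pair_space U) \<Longrightarrow> F (y, g (Suc j) (h, y)) = V y"
  shows "(\<integral>\<^sup>+\<omega>. F (\<omega> (Suc j)) \<partial>trajectory_law U Q g x) =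
    (\<integral>\<^sup>+\<omega>. (\<integral>\<^sup>+y. V y \<partial>Q (\<omega> j)) \<partial>trajectory_law U Q g x)"
proof -
  have "(\<lambda>k. \<integral>\<^sup>+y. V y \<partial>Q k) \<in> borel_measurable (pair_space U)"
    using kernel unfolding stochastic_kernel_def
    by (intro measurable_compose[OF measurable_prob_algebraD nn_integral_measurable_subprob_algebra[OF V]])
  from nn_integral_trajectory_law[OF this, of j]
  have "(\<integral>\<^sup>+\<omega>. (\<integral>\<^sup>+y. V y \<partial>Q (\<omega> j)) \<partial>trajectory_law U Q g x) = (\<integral>\<^sup>+h. (\<integral>\<^sup>+y. V y \<partial>Q (h j)) \<partial>history_law (Suc j))" .
  also have "\<dots> = (\<integral>\<^sup>+h. \<integral>\<^sup>+k. F k \<partial>step_kernel U Q g x (Suc j) h \<partial>history_law (Suc j))"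
    by (intro nn_integral_cong) (simp add: nn_integral_step_kernel[OF F] space_history_law FV del: IT.C.simps)
  finally show ?thesis
    unfolding nn_integral_trajectory_law[OF F] nn_integral_history_law_Suc[OF F, of "Suc j"] by simp
qed

lemma nn_integral_trajectory_le:
  assumes F: "F \<in> borel_measurable (pair_space U)" and le: "\<And>k. k \<in> feasible_pairs U \<Longrightarrow> F k \<le> c"
  shows "(\<integral>\<^sup>+\<omega>. F (\<omega> j) \<partial>trajectory_law U Q g x) \<le> c"
proof -
  interpret H: prob_space "history_law (Suc j)" by (rule prob_space_history_law)
  have "h j \<in> feasible_pairs U" if "h \<in> space (history_law (Suc j))" for h
    using that unfolding space_history_law by (auto simp: space_PiM space_pair_space PiE_iff)
  then have "(\<integral>\<^sup>+h. F (h j) \<partial>history_law (Suc j)) \<le> (\<integral>\<^sup>+h. c \<partial>history_law (Suc j))"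
    by (intro nn_integral_mono le)
  also have "\<dots> = c" using H.emeasure_space_1 by (simp del: IT.C.simps)
  finally show ?thesis unfolding nn_integral_trajectory_law[OF F] .
qed

lemma trajectory_feasible:
  assumes "\<omega> \<in> space (trajectory_law U Q g x)"
  shows "\<omega> j \<in> feasible_pairs U"
  using assms sets_eq_imp_space_eq[OF sets_trajectory_law] by (auto simp: space_PiM space_pair_space)

lemma trajectory_coordinate_measurable:
  assumes "F \<in> pair_space U \<rightarrow>\<^sub>M N"
  shows "(\<lambda>\<omega>. F (\<omega> j)) \<in> trajectory_law U Q g x \<rightarrow>\<^sub>M N"
  by (subst measurable_cong_sets[OF sets_trajectory_law refl]) (rule coordinate_measurable[OF _ assms], simp)

lemma discounted_cost_eq:
  assumes f: "f \<in> borel_measurable (pair_space U)" "\<And>k. k \<in> feasible_pairs U \<Longrightarrow> 0 \<le> f k"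
    "\<And>k. k \<in> feasible_pairs U \<Longrightarrow> f k \<le> b" and \<alpha>: "0 \<le> \<alpha>" "\<alpha> < 1"
  shows "0 \<le> discounted_cost U Q f \<alpha> g x"
    "ennreal (discounted_cost U Q f \<alpha> g x) =
    (\<Sum>j. ennreal (\<alpha> ^ j) * (\<integral>\<^sup>+\<omega>. ennreal (f (\<omega> j)) \<partial>trajectory_law U Q g x))"
proof -
  let ?P = "trajectory_law U Q g x"
  note sp = trajectory_feasible
  have b: "0 \<le> b" using f(2,3) sp
    by (metis (no_types, lifting) IT.space_PiM_not_empty equals0I order_trans sets_eq_imp_space_eq sets_trajectory_law)
  note fj = trajectory_coordinate_measurable[OF f(1)]
  have nn: "0 \<le> \<alpha> ^ j * f (\<omega> j)" if "\<omega> \<in> space ?P" for \<omega> j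
    using f(2)[OF sp[OF that]] \<alpha> by simp
  have summ: "summable (\<lambda>j. \<alpha> ^ j * f (\<omega> j))" if "\<omega> \<in> space ?P" for \<omega>
  proof (rule summable_comparison_test'[of "\<lambda>j. \<alpha> ^ j * b"])
    show "summable (\<lambda>j. \<alpha> ^ j * b)" using \<alpha> by (intro summable_mult2 summable_geometric) simp
    show "norm (\<alpha> ^ n * f (\<omega> n)) \<le> \<alpha> ^ n * b" for n
      using f(2,3)[OF sp[OF that]] \<alpha> by (simp add: abs_mult mult_left_mono)
  qed
  have "(\<integral>\<^sup>+\<omega>. ennreal (\<Sum>j. \<alpha> ^ j * f (\<omega> j)) \<partial>?P) = (\<integral>\<^sup>+\<omega>. (\<Sum>j. ennreal (\<alpha> ^ j) * ennreal (f (\<omega> j))) \<partial>?P)"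
  proof (rule nn_integral_cong)
    fix \<omega> assume w: "\<omega> \<in> space ?P"
    show "ennreal (\<Sum>j. \<alpha> ^ j * f (\<omega> j)) = (\<Sum>j. ennreal (\<alpha> ^ j) * ennreal (f (\<omega> j)))"
      using suminf_ennreal2[OF nn[OF w] summ[OF w]] \<alpha> f(2)[OF sp[OF w]] by (simp add: ennreal_mult)
  qed
  also have "\<dots> = (\<Sum>j. \<integral>\<^sup>+\<omega>. ennreal (\<alpha> ^ j) * ennreal (f (\<omega> j)) \<partial>?P)"
    using fj by (intro nn_integral_suminf) measurable
  also have "\<dots> = (\<Sum>j. ennreal (\<alpha> ^ j) * (\<integral>\<^sup>+\<omega>. ennreal (f (\<omega> j)) \<partial>?P))"
    using fj by (intro arg_cong[where f = suminf] ext nn_integral_cmult) measurable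
  finally have eq: "(\<integral>\<^sup>+\<omega>. ennreal (\<Sum>j. \<alpha> ^ j * f (\<omega> j)) \<partial>?P) =
    (\<Sum>j. ennreal (\<alpha> ^ j) * (\<integral>\<^sup>+\<omega>. ennreal (f (\<omega> j)) \<partial>?P))" .
  have "(\<Sum>j. ennreal (\<alpha> ^ j) * (\<integral>\<^sup>+\<omega>. ennreal (f (\<omega> j)) \<partial>?P)) \<le> (\<Sum>j. ennreal (\<alpha> ^ j) * ennreal b)"
    using f(1) by (intro suminf_le mult_left_mono nn_integral_trajectory_le) (auto intro!: ennreal_leI f(3))
  also have "\<dots> = ennreal (\<Sum>j. \<alpha> ^ j * b)"
  proof -
    have "summable (\<lambda>j. \<alpha> ^ j * b)" using \<alpha> by (intro summable_mult2 summable_geometric) simp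
    then have "(\<Sum>j. ennreal (\<alpha> ^ j * b)) = ennreal (\<Sum>j. \<alpha> ^ j * b)"
      using \<alpha> b by (intro suminf_ennreal2) simp_all
    then show ?thesis using \<alpha> b by (simp only: ennreal_mult zero_le_power)
  qed
  finally have fin: "(\<integral>\<^sup>+\<omega>. ennreal (\<Sum>j. \<alpha> ^ j * f (\<omega> j)) \<partial>?P) < \<infinity>"
    unfolding eq by (rule le_less_trans) simp
  have "(\<lambda>\<omega>. \<Sum>j. \<alpha> ^ j * f (\<omega> j)) \<in> borel_measurable ?P"
    using fj by measurable
  moreover have "AE \<omega> in ?P. 0 \<le> (\<Sum>j. \<alpha> ^ j * f (\<omega> j))"
    by (intro AE_I2 suminf_nonneg summ nn)
  ultimately have cost: "discounted_cost U Q f \<alpha> g x = enn2real (\<integral>\<^sup>+\<omega>. ennreal (\<Sum>j. \<alpha> ^ j * f (\<omega> j)) \<partial>?P)"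
    unfolding discounted_cost_def by (rule integral_eq_nn_integral)
  then show "0 \<le> discounted_cost U Q f \<alpha> g x" by simp
  show "ennreal (discounted_cost U Q f \<alpha> g x) =
    (\<Sum>j. ennreal (\<alpha> ^ j) * (\<integral>\<^sup>+\<omega>. ennreal (f (\<omega> j)) \<partial>?P))"
    using fin by (simp only: cost ennreal_enn2real infinity_ennreal_def eq[symmetric])
qed

end

section \<open>The optimal discounted cost\<close>

text \<open>A candidate value function \<open>v\<close> for the ordinary discounted control problem with known kernel \<open>Q\<close>.\<close>

locale discounted_value =
  fixes U :: "'x::polish_space \<Rightarrow> 'u::polish_space set"
    and Q :: "'x \<times> 'u \<Rightarrow> 'x measure" and f :: "'x \<times> 'u \<Rightarrow> real" and \<alpha> b :: real and v :: "'x \<Rightarrow> real"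
  assumes kernel: "stochastic_kernel U Q"
    and cost: "f \<in> borel_measurable (pair_space U)"
      "\<And>k. k \<in> feasible_pairs U \<Longrightarrow> 0 \<le> f k" "\<And>k. k \<in> feasible_pairs U \<Longrightarrow> f k \<le> b"
    and discount: "0 < \<alpha>" "\<alpha> < 1"
    and v: "v \<in> bounded_measurable" "\<And>x. 0 \<le> v x"
begin

text \<open>Cost of one stage plus the discounted candidate value of the next state, as an extended
  nonnegative real.\<close>

definition one_step :: "'x \<times> 'u \<Rightarrow> ennreal" where
  "one_step k = ennreal (f k) + ennreal \<alpha> * (\<integral>\<^sup>+y. ennreal (v y) \<partial>Q k)"

lemma one_step_eq:
  assumes "k \<in> feasible_pairs U"
  shows "one_step k = ennreal (f k + \<alpha> * (\<integral>y. v y \<partial>Q k))"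
proof -
  have "(\<integral>\<^sup>+y. ennreal (v y) \<partial>Q k) = ennreal (\<integral>y. v y \<partial>Q k)"
    using integrable_bounded_measurable[OF v(1) stochastic_kernelD[OF kernel assms]] v(2)
    by (intro nn_integral_eq_integral) simp_all
  then show ?thesis
    using cost(2)[OF assms] discount v(2) by (simp add: one_step_def ennreal_plus ennreal_mult)
qed

lemma v_measurable: "(\<lambda>y. ennreal (v y)) \<in> borel_measurable borel"
  using bounded_measurableD(1)[OF v(1)] by simp

lemma kernel_nn_integral_measurable:
  "V \<in> borel_measurable borel \<Longrightarrow> (\<lambda>k. \<integral>\<^sup>+y. V y \<partial>Q k) \<in> borel_measurable (pair_space U)"
  using kernel unfolding stochastic_kernel_def
  by (intro measurable_compose[OF measurable_prob_algebraD nn_integral_measurable_subprob_algebra])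

lemma one_step_measurable: "one_step \<in> borel_measurable (pair_space U)"
  unfolding one_step_def[abs_def]
  using cost(1) kernel_nn_integral_measurable[OF v_measurable]
  by (intro borel_measurable_add borel_measurable_times) simp_all

lemma fst_measurable_pair_space: "fst \<in> pair_space U \<rightarrow>\<^sub>M borel"
  unfolding pair_space_def by (intro measurable_restrict_space1 measurable_fst)

lemma value_le_discounted_cost:
  assumes le: "\<And>k. k \<in> feasible_pairs U \<Longrightarrow> ennreal (v (fst k)) \<le> one_step k"
    and g: "g \<in> strategies U"
  shows "v x \<le> discounted_cost U Q f \<alpha> g x"
proof -
  interpret controlled_process U Q g x by unfold_locales (fact kernel g)+
  let ?P = "trajectory_law U Q g x"
  define a where "a j = (\<integral>\<^sup>+\<omega>. ennreal (v (fst (\<omega> j))) \<partial>?P)" for j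
  define F where "F j = (\<integral>\<^sup>+\<omega>. ennreal (f (\<omega> j)) \<partial>?P)" for j
  have v_fst: "(\<lambda>k. ennreal (v (fst k))) \<in> borel_measurable (pair_space U)"
    by (rule measurable_compose[OF fst_measurable_pair_space v_measurable])
  have a0: "a 0 = ennreal (v x)"
    unfolding a_def using nn_integral_trajectory_0[OF v_fst] by simp
  have step: "a j \<le> F j + ennreal \<alpha> * a (Suc j)" for j
  proof -
    have "a j \<le> (\<integral>\<^sup>+\<omega>. one_step (\<omega> j) \<partial>?P)"
      unfolding a_def by (intro nn_integral_mono le trajectory_feasible)
    also have "\<dots> = F j + (\<integral>\<^sup>+\<omega>. ennreal \<alpha> * (\<integral>\<^sup>+y. ennreal (v y) \<partial>Q (\<omega> j)) \<partial>?P)"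
      unfolding one_step_def F_def
      using trajectory_coordinate_measurable[OF cost(1)]
        trajectory_coordinate_measurable[OF kernel_nn_integral_measurable[OF v_measurable]]
      by (intro nn_integral_add borel_measurable_times) simp_all
    also have "(\<integral>\<^sup>+\<omega>. ennreal \<alpha> * (\<integral>\<^sup>+y. ennreal (v y) \<partial>Q (\<omega> j)) \<partial>?P) =
        ennreal \<alpha> * (\<integral>\<^sup>+\<omega>. (\<integral>\<^sup>+y. ennreal (v y) \<partial>Q (\<omega> j)) \<partial>?P)"
      by (intro nn_integral_cmult trajectory_coordinate_measurable kernel_nn_integral_measurable v_measurable)
    also have "(\<integral>\<^sup>+\<omega>. (\<integral>\<^sup>+y. ennreal (v y) \<partial>Q (\<omega> j)) \<partial>?P) = a (Suc j)"
      unfolding a_def by (rule nn_integral_trajectory_Suc[symmetric, OF v_fst v_measurable]) simp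
    finally show ?thesis .
  qed
  have partial: "a 0 \<le> (\<Sum>j<n. ennreal (\<alpha> ^ j) * F j) + ennreal (\<alpha> ^ n) * a n" for n
  proof (induction n)
    case (Suc n)
    note Suc
    also have "(\<Sum>j<n. ennreal (\<alpha> ^ j) * F j) + ennreal (\<alpha> ^ n) * a n
        \<le> (\<Sum>j<n. ennreal (\<alpha> ^ j) * F j) + ennreal (\<alpha> ^ n) * (F n + ennreal \<alpha> * a (Suc n))"
      by (intro add_left_mono mult_left_mono step) simp
    also have "\<dots> = (\<Sum>j<Suc n. ennreal (\<alpha> ^ j) * F j) + ennreal (\<alpha> ^ Suc n) * a (Suc n)"
      using discount by (simp add: distrib_left ennreal_mult mult_ac add_ac)
    finally show ?case .
  qed simp
  have nonneg: "0 \<le> discounted_cost U Q f \<alpha> g x"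
    using discounted_cost_eq(1)[OF cost] discount by simp
  have "v x \<le> discounted_cost U Q f \<alpha> g x + \<alpha> ^ n * sup_norm v" for n
  proof -
    have "a n \<le> ennreal (sup_norm v)"
      unfolding a_def
    proof (rule nn_integral_trajectory_le[OF v_fst])
      show "ennreal (v (fst k)) \<le> ennreal (sup_norm v)" for k
        using bounded_measurableD(2)[OF v(1), of "fst k"] by (intro ennreal_leI) linarith
    qed
    moreover have "(\<Sum>j<n. ennreal (\<alpha> ^ j) * F j) \<le> (\<Sum>j. ennreal (\<alpha> ^ j) * F j)"
      by (rule sum_le_suminf) simp_all
    then have "(\<Sum>j<n. ennreal (\<alpha> ^ j) * F j) \<le> ennreal (discounted_cost U Q f \<alpha> g x)"
      using discounted_cost_eq(2)[OF cost] discount by (simp add: F_def)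
    ultimately have "a 0 \<le> ennreal (discounted_cost U Q f \<alpha> g x) + ennreal (\<alpha> ^ n) * ennreal (sup_norm v)"
      using order_trans[OF partial add_mono[OF _ mult_left_mono]] by simp
    then have "ennreal (v x) \<le> ennreal (discounted_cost U Q f \<alpha> g x + \<alpha> ^ n * sup_norm v)"
      using discount nonneg sup_norm_nonneg[OF v(1)] by (simp add: a0 ennreal_plus ennreal_mult)
    then show ?thesis
      by (rule ennreal_le_iff[THEN iffD1, rotated]) (use discount nonneg sup_norm_nonneg[OF v(1)] in simp)
  qed
  moreover have "(\<lambda>n. discounted_cost U Q f \<alpha> g x + \<alpha> ^ n * sup_norm v)
      \<longlonglongrightarrow> discounted_cost U Q f \<alpha> g x + 0 * sup_norm v"
    using discount by (intro tendsto_intros LIMSEQ_realpow_zero) simp_all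
  ultimately show ?thesis
    using LIMSEQ_le_const by fastforce
qed

text \<open>A near-optimal selector for almost every state, corrected on the exceptional null set by the feasible
  selector \<open>s0\<close>, so that it is feasible everywhere.\<close>

lemma near_optimal_selector:
  assumes U: "feasible_pairs U \<in> sets (borel \<Otimes>\<^sub>M borel)"
    and near: "\<And>y. \<exists>u\<in>U y. one_step (y, u) \<le> ennreal (v y + \<epsilon>)"
    and s0: "s0 \<in> borel_measurable borel" "\<And>y. s0 y \<in> U y"
    and M: "prob_space M" "sets M = sets borel"
  shows "\<exists>s\<in>borel_measurable borel. (\<forall>y. s y \<in> U y) \<and> (AE y in M. one_step (y, s y) \<le> ennreal (v y + \<epsilon>))"
proof -
  define B where "B = {k \<in> space (pair_space U). one_step k \<le> ennreal (v (fst k) + \<epsilon>)}"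
  have "(\<lambda>y. ennreal (v y + \<epsilon>)) \<in> borel_measurable borel"
    using bounded_measurableD(1)[OF v(1)] by simp
  from measurable_compose[OF fst_measurable_pair_space this]
  have "(\<lambda>k. ennreal (v (fst k) + \<epsilon>)) \<in> borel_measurable (pair_space U)" .
  then have "B \<in> sets (pair_space U)"
    unfolding B_def using one_step_measurable by measurable
  then have B: "B \<in> sets borel"
    using U unfolding pair_space_def borel_prod by (simp add: sets_restrict_space_iff)
  have "\<exists>u. (y, u) \<in> B" for y
    using near[of y] by (auto simp: B_def space_pair_space feasible_pairs_def)
  then obtain s where s: "s \<in> borel_measurable borel" "AE y in M. (y, s y) \<in> B"
    using measurable_selection_AE[OF B _ prob_space.finite_measure[OF M(1)] M(2)] by blast
  let ?s = "\<lambda>y. if y \<in> {y. (y, s y) \<in> B} then s y else s0 y"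
  have "(\<lambda>y. (y, s y)) \<in> borel \<rightarrow>\<^sub>M borel"
    using s(1) by (simp add: borel_prod[symmetric])
  from measurable_sets[OF this B] have "{y. (y, s y) \<in> B} \<in> sets borel" by (simp add: vimage_def)
  then have "?s \<in> borel_measurable borel"
    using s(1) s0(1) by (intro measurable_If_set) simp_all
  moreover have "?s y \<in> U y" for y
    using s0(2) by (auto simp: B_def space_pair_space feasible_pairs_def)
  moreover have "AE y in M. one_step (y, ?s y) \<le> ennreal (v y + \<epsilon>)"
    using s(2) by eventually_elim (simp add: B_def)
  ultimately show ?thesis by (intro bexI[of _ ?s] conjI allI)
qed

text \<open>The strategy is Markov: at time \<open>j\<close> it uses a selector that is near-optimal for almost every state
  under the law \<open>law j\<close> of the state at time \<open>j\<close>. That law depends only on the selectors used before \<open>j\<close>,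
  so laws and selectors are constructed together by recursion. The strategy may depend on the initial
  state \<open>x\<close>.\<close>

lemma discounted_cost_near_optimal:
  assumes U: "feasible_pairs U \<in> sets (borel \<Otimes>\<^sub>M borel)" and ne: "strategies U \<noteq> {}"
    and \<epsilon>: "0 \<le> \<epsilon>" and near: "\<And>y. \<exists>u\<in>U y. one_step (y, u) \<le> ennreal (v y + \<epsilon>)"
  shows "\<exists>g\<in>strategies U. discounted_cost U Q f \<alpha> g x \<le> v x + \<epsilon> / (1 - \<alpha>)"
proof -
  obtain g0 where g0: "g0 \<in> strategies U" using ne by blast
  interpret g0: controlled_process U Q g0 x by unfold_locales (fact kernel g0)+
  have h: "(\<lambda>_. undefined) \<in> space (\<Pi>\<^sub>M i\<in>{0..<0::nat}. pair_space U)" by (simp add: space_PiM)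
  \<comment> \<open>The rule of any strategy at time 0 is a feasible Borel selector.\<close>
  define s0 where "s0 y = g0 0 (\<lambda>_. undefined, y)" for y
  have s0: "s0 \<in> borel_measurable borel" "\<And>y. s0 y \<in> U y"
    unfolding s0_def using measurable_Pair2[OF g0.strategy_measurable h] g0.strategy_feasible[OF h] by simp_all
  define good where "good M t \<longleftrightarrow> t \<in> borel_measurable borel \<and> (\<forall>y. t y \<in> U y) \<and>
      (AE y in M. one_step (y, t y) \<le> ennreal (v y + \<epsilon>))" for M :: "'x measure" and t
  define sel where "sel M = (SOME t. good M t)" for M
  have "good M (sel M)" if "prob_space M" "sets M = sets borel" for M
  proof -
    have "\<exists>t. good M t"
      using near_optimal_selector[OF U near s0 that] unfolding good_def by blast
    then show ?thesis unfolding sel_def by (rule someI_ex)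
  qed
  then have sel: "sel M \<in> borel_measurable borel" "sel M y \<in> U y"
      "AE y in M. one_step (y, sel M y) \<le> ennreal (v y + \<epsilon>)"
    if "prob_space M" "sets M = sets borel" for M y
    using that by (simp_all add: good_def)
  define law where "law = rec_nat (return borel x) (\<lambda>_ M. M \<bind> (\<lambda>y. Q (y, sel M y)))"
  define s where "s j = sel (law j)" for j
  have law_0: "law 0 = return borel x" and law_Suc: "law (Suc j) = law j \<bind> (\<lambda>y. Q (y, s j y))" for j
    by (simp_all add: law_def s_def)
  have graph: "(\<lambda>y. (y, t y)) \<in> borel \<rightarrow>\<^sub>M pair_space U"
    if "t \<in> borel_measurable borel" "\<And>y. t y \<in> U y" for t
    unfolding pair_space_def using that
    by (intro measurable_restrict_space2 measurable_Pair measurable_ident_sets) (auto simp: feasible_pairs_def)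
  have law: "law j \<in> space (prob_algebra borel)" for j
  proof (induction j)
    case 0
    show ?case by (simp add: law_0 space_prob_algebra prob_space_return)
  next
    case (Suc j)
    then have P: "prob_space (law j)" "sets (law j) = sets borel" by (simp_all add: space_prob_algebra)
    have "(\<lambda>y. Q (y, s j y)) \<in> borel \<rightarrow>\<^sub>M prob_algebra borel"
      using graph[OF sel(1,2)[OF P]] kernel unfolding s_def stochastic_kernel_def
      by (rule measurable_compose)
    from prob_space_bind'[OF Suc this] sets_bind'[OF Suc this]
    show ?case by (simp add: law_Suc space_prob_algebra)
  qed
  then have P: "prob_space (law j)" "sets (law j) = sets borel" for j by (simp_all add: space_prob_algebra)
  have s: "s j \<in> borel_measurable borel" "s j y \<in> U y" for j y
    unfolding s_def using sel(1,2)[OF P] by auto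
  have trans: "(\<lambda>y. Q (y, s j y)) \<in> law j \<rightarrow>\<^sub>M subprob_algebra borel" for j
    unfolding measurable_cong_sets[OF P(2) refl]
    using measurable_compose[OF graph[OF s] kernel[unfolded stochastic_kernel_def]]
    by (rule measurable_prob_algebraD)
  define g :: "nat \<Rightarrow> (nat \<Rightarrow> 'x \<times> 'u) \<times> 'x \<Rightarrow> 'u" where "g j = (\<lambda>(h, y). s j y)" for j
  have g: "g \<in> strategies U"
  proof -
    have "g j \<in> (\<Pi>\<^sub>M i\<in>{0..<j}. pair_space U) \<Otimes>\<^sub>M borel \<rightarrow>\<^sub>M borel" for j
      using measurable_compose[OF measurable_snd s(1)[of j]] by (simp add: g_def case_prod_beta')
    then show ?thesis using s(2) by (simp add: strategies_def g_def)
  qed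
  interpret controlled_process U Q g x by unfold_locales (fact kernel g)+
  have stage: "(\<integral>\<^sup>+\<omega>. F (\<omega> j) \<partial>trajectory_law U Q g x) = (\<integral>\<^sup>+y. F (y, s j y) \<partial>law j)"
    if F: "F \<in> borel_measurable (pair_space U)" for F j
    using F
  proof (induction j arbitrary: F)
    case 0
    have "g 0 (\<lambda>_. undefined, x) = s 0 x" by (simp add: g_def)
    then show ?case
      using nn_integral_trajectory_0[OF 0] measurable_compose[OF graph[OF s] 0]
      by (simp add: law_0 nn_integral_return)
  next
    case (Suc j)
    let ?V = "\<lambda>y. F (y, s (Suc j) y)"
    have V: "?V \<in> borel_measurable borel" by (rule measurable_compose[OF graph[OF s] Suc.prems])
    have "(\<integral>\<^sup>+\<omega>. F (\<omega> (Suc j)) \<partial>trajectory_law U Q g x) = (\<integral>\<^sup>+\<omega>. (\<integral>\<^sup>+y. ?V y \<partial>Q (\<omega> j)) \<partial>trajectory_law U Q g x)"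
      by (rule nn_integral_trajectory_Suc[OF Suc.prems V]) (simp add: g_def)
    also have "\<dots> = (\<integral>\<^sup>+z. (\<integral>\<^sup>+y. ?V y \<partial>Q (z, s j z)) \<partial>law j)"
      by (rule Suc.IH[OF kernel_nn_integral_measurable[OF V]])
    also have "\<dots> = (\<integral>\<^sup>+y. ?V y \<partial>law (Suc j))"
      unfolding law_Suc by (rule nn_integral_bind[symmetric, OF V trans])
    finally show ?case .
  qed
  define F where "F j = (\<integral>\<^sup>+\<omega>. ennreal (f (\<omega> j)) \<partial>trajectory_law U Q g x)" for j
  define a where "a j = (\<integral>\<^sup>+y. ennreal (v y) \<partial>law j)" for j
  have step: "F j + ennreal \<alpha> * a (Suc j) \<le> a j + ennreal \<epsilon>" for j
  proof -
    interpret prob_space "law j" by (rule P)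
    have meas: "(\<lambda>y. G (y, s j y)) \<in> borel_measurable (law j)" if "G \<in> borel_measurable (pair_space U)" for G :: "_ \<Rightarrow> ennreal"
      unfolding measurable_cong_sets[OF P(2) refl] by (rule measurable_compose[OF graph[OF s] that])
    have f_meas: "(\<lambda>k. ennreal (f k)) \<in> borel_measurable (pair_space U)" using cost(1) by simp
    note Q_meas = kernel_nn_integral_measurable[OF v_measurable]
    have "a (Suc j) = (\<integral>\<^sup>+y. (\<integral>\<^sup>+z. ennreal (v z) \<partial>Q (y, s j y)) \<partial>law j)"
      unfolding a_def law_Suc by (rule nn_integral_bind[OF v_measurable trans])
    then have "F j + ennreal \<alpha> * a (Suc j) = (\<integral>\<^sup>+y. one_step (y, s j y) \<partial>law j)"
      unfolding F_def stage[OF f_meas] one_step_def using meas[OF f_meas] meas[OF Q_meas]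
      by (simp add: nn_integral_add nn_integral_cmult)
    also have "\<dots> \<le> (\<integral>\<^sup>+y. ennreal (v y) + ennreal \<epsilon> \<partial>law j)"
      using sel(3)[OF P] v(2) \<epsilon> by (intro nn_integral_mono_AE) (simp add: s_def ennreal_plus)
    also have "\<dots> = a j + ennreal \<epsilon>"
      unfolding a_def using v_measurable emeasure_space_1
      by (subst nn_integral_add) (simp_all add: measurable_cong_sets[OF P(2) refl])
    finally show ?thesis .
  qed
  have partial: "(\<Sum>j<n. ennreal (\<alpha> ^ j) * F j) + ennreal (\<alpha> ^ n) * a n \<le> a 0 + (\<Sum>j<n. ennreal (\<alpha> ^ j) * ennreal \<epsilon>)" for n
  proof (induction n)
    case (Suc n)
    have "(\<Sum>j<Suc n. ennreal (\<alpha> ^ j) * F j) + ennreal (\<alpha> ^ Suc n) * a (Suc n)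
        = (\<Sum>j<n. ennreal (\<alpha> ^ j) * F j) + ennreal (\<alpha> ^ n) * (F n + ennreal \<alpha> * a (Suc n))"
      using discount by (simp add: distrib_left ennreal_mult mult_ac add_ac)
    also have "\<dots> \<le> (\<Sum>j<n. ennreal (\<alpha> ^ j) * F j) + ennreal (\<alpha> ^ n) * (a n + ennreal \<epsilon>)"
      by (intro add_left_mono mult_left_mono step) simp
    also have "\<dots> = ((\<Sum>j<n. ennreal (\<alpha> ^ j) * F j) + ennreal (\<alpha> ^ n) * a n) + ennreal (\<alpha> ^ n) * ennreal \<epsilon>"
      by (simp add: distrib_left add_ac)
    also have "\<dots> \<le> (a 0 + (\<Sum>j<n. ennreal (\<alpha> ^ j) * ennreal \<epsilon>)) + ennreal (\<alpha> ^ n) * ennreal \<epsilon>"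
      by (intro add_right_mono Suc)
    finally show ?case by (simp add: add_ac)
  qed simp
  have a0: "a 0 = ennreal (v x)"
    unfolding a_def law_0 using v_measurable by (simp add: nn_integral_return)
  have "(\<Sum>j. ennreal (\<alpha> ^ j) * F j) \<le> ennreal (v x + \<epsilon> / (1 - \<alpha>))"
  proof (rule suminf_le_const)
    fix n
    have "(\<Sum>j<n. ennreal (\<alpha> ^ j) * F j) \<le> a 0 + (\<Sum>j<n. ennreal (\<alpha> ^ j) * ennreal \<epsilon>)"
      by (rule order_trans[OF _ partial]) simp
    also have "\<dots> = ennreal (v x + (\<Sum>j<n. \<alpha> ^ j * \<epsilon>))"
      using \<epsilon> discount v(2) by (simp add: a0 ennreal_plus sum_nonneg ennreal_mult flip: sum_ennreal)
    also have "\<dots> \<le> ennreal (v x + \<epsilon> / (1 - \<alpha>))"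
    proof -
      have "(\<Sum>j<n. \<alpha> ^ j) \<le> 1 / (1 - \<alpha>)"
        using sum_le_suminf[of "\<lambda>j. \<alpha> ^ j" "{..<n}"] discount by (simp add: suminf_geometric summable_geometric)
      from mult_right_mono[OF this \<epsilon>] show ?thesis
        by (intro ennreal_leI) (simp add: sum_distrib_right)
    qed
    finally show "(\<Sum>j<n. ennreal (\<alpha> ^ j) * F j) \<le> ennreal (v x + \<epsilon> / (1 - \<alpha>))" .
  qed simp
  then have "ennreal (discounted_cost U Q f \<alpha> g x) \<le> ennreal (v x + \<epsilon> / (1 - \<alpha>))"
    using discounted_cost_eq(2)[OF cost] discount by (simp add: F_def)
  moreover have "0 \<le> v x + \<epsilon> / (1 - \<alpha>)" using v(2) \<epsilon> discount by simp
  ultimately show ?thesis using g by (simp only: ennreal_le_iff) blast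
qed

end

text \<open>With a maximizing kernel the dynamic programming equation for \<open>v\<close> becomes the ordinary discounted
  equation for \<open>Q\<close>.\<close>

theorem (in control_model) value_eq_optimal_cost:
  assumes U: "feasible_pairs U \<in> sets (borel \<Otimes>\<^sub>M borel)" and ne: "strategies U \<noteq> {}"
    and f: "f \<in> borel_measurable (pair_space U)" "\<And>k. k \<in> feasible_pairs U \<Longrightarrow> f k \<le> b"
    and v: "v \<in> bounded_measurable" "\<And>x. v x = T v x" "\<And>x. 0 \<le> v x"
    and Q: "maximizing_kernel U Qo R v Q"
  shows "v x = (INF g\<in>strategies U. discounted_cost U Q f \<alpha> g x)"
proof -
  interpret D: discounted_value U Q f \<alpha> b v
    using Q f v(1,3) cost_nonneg discount by unfold_locales (auto simp: maximizing_kernel_def)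
  have T: "v y = (INF u\<in>U y. f (y, u) + \<alpha> * (\<integral>z. v z \<partial>Q (y, u)))" for y
  proof -
    have "f (y, u) + \<alpha> * (\<integral>z. v z \<partial>Qo (y, u)) + \<alpha> * (R / 2) * oscillation v =
        f (y, u) + \<alpha> * (\<integral>z. v z \<partial>Q (y, u))" if "u \<in> U y" for u
      using integral_maximizing_kernel[OF nominal Q v(1), of "(y, u)"] that
      by (simp add: feasible_pairs_def algebra_simps)
    then have "T v y = (INF u\<in>U y. f (y, u) + \<alpha> * (\<integral>z. v z \<partial>Q (y, u)))"
      unfolding T_eq by (rule INF_cong[OF refl])
    with v(2)[of y] show ?thesis by (rule trans)
  qed
  have bdd: "bdd_below ((\<lambda>u. f (y, u) + \<alpha> * (\<integral>z. v z \<partial>Q (y, u))) ` U y)" for y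
    by (rule bdd_belowI2[of _ 0]) (use cost_nonneg discount v(3) in \<open>simp add: feasible_pairs_def\<close>)
  have le: "ennreal (v (fst k)) \<le> D.one_step k" if k: "k \<in> feasible_pairs U" for k
  proof -
    have "v (fst k) \<le> f k + \<alpha> * (\<integral>z. v z \<partial>Q k)"
      using cINF_lower[OF bdd, of "snd k" "fst k"] k T[of "fst k"] by (auto simp: feasible_pairs_def)
    then show ?thesis unfolding D.one_step_eq[OF k] by (rule ennreal_leI)
  qed
  have near: "\<exists>u\<in>U y. D.one_step (y, u) \<le> ennreal (v y + \<epsilon>)" if "0 < \<epsilon>" for y \<epsilon>
  proof -
    have "(INF u\<in>U y. f (y, u) + \<alpha> * (\<integral>z. v z \<partial>Q (y, u))) < v y + \<epsilon>" using T[of y] that by linarith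
    then obtain u where u: "u \<in> U y" "f (y, u) + \<alpha> * (\<integral>z. v z \<partial>Q (y, u)) < v y + \<epsilon>"
      using cINF_less_iff[OF nonempty bdd] by blast
    then have k: "(y, u) \<in> feasible_pairs U" by (simp add: feasible_pairs_def)
    show ?thesis using u by (intro bexI[of _ u]) (simp_all add: D.one_step_eq[OF k] ennreal_leI)
  qed
  have lower: "v x \<le> discounted_cost U Q f \<alpha> g x" if "g \<in> strategies U" for g
    by (rule D.value_le_discounted_cost[OF le that])
  have bdd_cost: "bdd_below ((\<lambda>g. discounted_cost U Q f \<alpha> g x) ` strategies U)"
    by (rule bdd_belowI2) (rule lower)
  show ?thesis
  proof (rule antisym)
    show "v x \<le> (INF g\<in>strategies U. discounted_cost U Q f \<alpha> g x)"
      by (rule cINF_greatest[OF ne lower])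
    show "(INF g\<in>strategies U. discounted_cost U Q f \<alpha> g x) \<le> v x"
    proof (rule field_le_epsilon)
      fix e :: real assume "0 < e"
      \<comment> \<open>A loss of \<open>e * (1 - \<alpha>)\<close> at every stage costs \<open>e\<close> in total.\<close>
      then have e: "0 < e * (1 - \<alpha>)" using discount by simp
      from D.discounted_cost_near_optimal[OF U ne less_imp_le[OF e] near[OF e], of x]
      obtain g where g: "g \<in> strategies U" "discounted_cost U Q f \<alpha> g x \<le> v x + e"
        using discount by auto
      show "(INF g\<in>strategies U. discounted_cost U Q f \<alpha> g x) \<le> v x + e"
        by (rule order_trans[OF cINF_lower[OF bdd_cost g(1)] g(2)])
    qed
  qed
qed

section \<open>The dynamic programming theorem\<close>

theorem theorem3p13:
  fixes U :: "'x::polish_space \<Rightarrow> 'u::polish_space set"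
    and Qo :: "'x \<times> 'u \<Rightarrow> 'x measure"
    and f :: "'x \<times> 'u \<Rightarrow> real"
    and \<alpha> R :: real
  defines "T \<equiv> dp_operator U Qo f \<alpha> R"
    and "L \<equiv> bounded_measurable"
  assumes "\<And>x. U x \<noteq> {}"
    and "\<And>x. U x \<in> sets borel"
    and "feasible_pairs U \<in> sets (borel \<Otimes>\<^sub>M borel)"
    and "stochastic_kernel U Qo"
    and "continuous_on (feasible_pairs U) f"
    and "bdd_above (f ` feasible_pairs U)"
    and "\<And>k. k \<in> feasible_pairs U \<Longrightarrow> 0 \<le> f k"
    and "0 < \<alpha>" and "\<alpha> < 1"
    and "0 \<le> R" and "R \<le> 2"
  shows
    "(\<forall>v. v \<in> L \<and> (\<forall>x. v x = T v x) \<and> continuous_on UNIV v \<and> (\<forall>x. 0 \<le> v x) \<longrightarrow>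
        (\<exists>!w. w \<in> L \<and> (\<forall>x. w x = T w x)) \<and>
        (strategies U \<noteq> {} \<longrightarrow>
           (\<forall>Q. maximizing_kernel U Qo R v Q \<longrightarrow>
              (\<forall>x. v x = (INF g\<in>strategies U. discounted_cost U Q f \<alpha> g x))))) \<and>
     (T ` L \<subseteq> L \<longrightarrow>
        (\<exists>!v. v \<in> L \<and> (\<forall>x. v x = T v x)) \<and>
        (\<alpha> * (1 + R) < 1 \<longrightarrow> contraction_on L T) \<and>
        (\<forall>V\<in>L. \<forall>W\<in>L.
           (\<exists>Q. maximizing_kernel U Qo R V Q) \<and> (\<exists>Q. maximizing_kernel U Qo R W Q) \<longrightarrow>
           sup_norm (\<lambda>x. T V x - T W x) \<le> \<alpha> * sup_norm (\<lambda>x. V x - W x)) \<and>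
        (\<exists>N\<ge>1. contraction_on L (T ^^ N)) \<and>
        (\<forall>v. v \<in> L \<and> (\<forall>x. v x = T v x) \<longrightarrow>
           (\<forall>V\<in>L. (\<lambda>n. sup_norm (\<lambda>x. (T ^^ n) V x - v x)) \<longlonglongrightarrow> 0 \<and>
              (\<forall>x. (\<lambda>n. (T ^^ n) V x) \<longlonglongrightarrow> v x))))"
proof -
  interpret M: control_model U Qo f \<alpha> R
    by unfold_locales (fact assms)+
  obtain b where b: "\<And>k. k \<in> feasible_pairs U \<Longrightarrow> f k \<le> b"
    using assms(8) by (auto simp: bdd_above_def)
  have f: "f \<in> borel_measurable (pair_space U)"
    using borel_measurable_continuous_on_restrict[OF assms(7)] by (simp add: pair_space_def borel_prod)
  have uniq: "v = w" if "v \<in> L" "\<forall>x. v x = T v x" "w \<in> L" "\<forall>x. w x = T w x" for v w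
    using M.fixed_point_unique[of v w] that unfolding T_def L_def by blast
  have "(\<exists>!w. w \<in> L \<and> (\<forall>x. w x = T w x)) \<and>
        (strategies U \<noteq> {} \<longrightarrow>
           (\<forall>Q. maximizing_kernel U Qo R v Q \<longrightarrow>
              (\<forall>x. v x = (INF g\<in>strategies U. discounted_cost U Q f \<alpha> g x))))"
    if v: "v \<in> L \<and> (\<forall>x. v x = T v x) \<and> continuous_on UNIV v \<and> (\<forall>x. 0 \<le> v x)" for v
  proof (intro conjI impI allI)
    show "\<exists>!w. w \<in> L \<and> (\<forall>x. w x = T w x)"
      using v uniq by (intro ex1I[of _ v]) auto
    fix Q x assume "strategies U \<noteq> {}" "maximizing_kernel U Qo R v Q"
    then show "v x = (INF g\<in>strategies U. discounted_cost U Q f \<alpha> g x)"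
      using M.value_eq_optimal_cost[OF assms(5) _ f b] v unfolding T_def L_def by blast
  qed
  moreover have "(\<exists>!v. v \<in> L \<and> (\<forall>x. v x = T v x)) \<and>
        (\<alpha> * (1 + R) < 1 \<longrightarrow> contraction_on L T) \<and>
        (\<forall>V\<in>L. \<forall>W\<in>L.
           (\<exists>Q. maximizing_kernel U Qo R V Q) \<and> (\<exists>Q. maximizing_kernel U Qo R W Q) \<longrightarrow>
           sup_norm (\<lambda>x. T V x - T W x) \<le> \<alpha> * sup_norm (\<lambda>x. V x - W x)) \<and>
        (\<exists>N\<ge>1. contraction_on L (T ^^ N)) \<and>
        (\<forall>v. v \<in> L \<and> (\<forall>x. v x = T v x) \<longrightarrow>
           (\<forall>V\<in>L. (\<lambda>n. sup_norm (\<lambda>x. (T ^^ n) V x - v x)) \<longlonglongrightarrow> 0 \<and>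
              (\<forall>x. (\<lambda>n. (T ^^ n) V x) \<longlonglongrightarrow> v x)))"
    if inv: "T ` L \<subseteq> L"
  proof (intro conjI)
    have invL: "(T ^^ n) V \<in> L" if "V \<in> L" for n V
      using inv that by (induction n) auto
    note bound = M.iterate_bound[folded T_def L_def, OF inv]
    obtain w where "w \<in> L" "\<forall>x. w x = T w x"
      using M.fixed_point_exists[folded T_def L_def, OF inv] by blast
    then show "\<exists>!v. v \<in> L \<and> (\<forall>x. v x = T v x)" using uniq by (intro ex1I[of _ w]) auto
    show "\<alpha> * (1 + R) < 1 \<longrightarrow> contraction_on L T"
      unfolding contraction_on_def
      using inv assms(10,12) M.T_lipschitz[folded T_def L_def]
      by (auto intro!: exI[of _ "\<alpha> * (1 + R)"] sup_norm_le)
    show "\<forall>V\<in>L. \<forall>W\<in>L.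
        (\<exists>Q. maximizing_kernel U Qo R V Q) \<and> (\<exists>Q. maximizing_kernel U Qo R W Q) \<longrightarrow>
        sup_norm (\<lambda>x. T V x - T W x) \<le> \<alpha> * sup_norm (\<lambda>x. V x - W x)"
      using M.T_contraction_of_maximizing_kernels[folded T_def L_def] by blast
    show "\<exists>N\<ge>1. contraction_on L (T ^^ N)"
    proof -
      have "\<forall>\<^sub>F n in sequentially. 2 * (real (Suc n) * \<alpha> ^ n) * 1 < 1"
        by (rule order_tendstoD(2)[OF M.iterate_factor_tendsto]) simp
      moreover have "\<forall>\<^sub>F n in sequentially. (1::nat) \<le> n" by (rule eventually_ge_at_top)
      ultimately have "\<forall>\<^sub>F n in sequentially. 2 * (real (Suc n) * \<alpha> ^ n) * 1 < 1 \<and> 1 \<le> n"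
        by (rule eventually_conj)
      then obtain N where N: "2 * (real (Suc N) * \<alpha> ^ N) < 1" "1 \<le> N"
        unfolding eventually_sequentially by fastforce
      have "contraction_on L (T ^^ N)"
        unfolding contraction_on_def
        using N(1) assms(10) invL bound
        by (intro conjI exI[of _ "2 * (real (Suc N) * \<alpha> ^ N)"] ballI) auto
      with N(2) show ?thesis by blast
    qed
    show "\<forall>v. v \<in> L \<and> (\<forall>x. v x = T v x) \<longrightarrow>
        (\<forall>V\<in>L. (\<lambda>n. sup_norm (\<lambda>x. (T ^^ n) V x - v x)) \<longlonglongrightarrow> 0 \<and> (\<forall>x. (\<lambda>n. (T ^^ n) V x) \<longlonglongrightarrow> v x))"
    proof (intro allI impI ballI)
      fix v V assume v: "v \<in> L \<and> (\<forall>x. v x = T v x)" and V: "V \<in> L"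
      then have "T v = v" by auto
      then have iter_v: "(T ^^ n) v = v" for n by (induction n) simp_all
      have diff: "(\<lambda>x. (T ^^ n) V x - v x) \<in> bounded_measurable" for n
        using bounded_measurable_diff invL[OF V, of n] v unfolding L_def by blast
      have lim: "(\<lambda>n. sup_norm (\<lambda>x. (T ^^ n) V x - v x)) \<longlonglongrightarrow> 0"
      proof (rule tendsto_sandwich[OF _ _ tendsto_const M.iterate_factor_tendsto])
        show "\<forall>\<^sub>F n in sequentially. 0 \<le> sup_norm (\<lambda>x. (T ^^ n) V x - v x)"
          by (intro always_eventually allI sup_norm_nonneg diff)
        show "\<forall>\<^sub>F n in sequentially. sup_norm (\<lambda>x. (T ^^ n) V x - v x)
            \<le> 2 * (real (Suc n) * \<alpha> ^ n) * sup_norm (\<lambda>x. V x - v x)"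
          using bound[OF V, of v] v iter_v by (intro always_eventually allI) metis
      qed
      moreover have "(\<lambda>n. (T ^^ n) V x) \<longlonglongrightarrow> v x" for x
      proof -
        have "(\<lambda>n. (T ^^ n) V x - v x) \<longlonglongrightarrow> 0"
          by (rule Lim_null_comparison[OF _ lim])
             (use bounded_measurableD(2)[OF diff] in \<open>simp add: always_eventually\<close>)
        then show ?thesis by (simp add: LIM_zero_iff)
      qed
      ultimately show "(\<lambda>n. sup_norm (\<lambda>x. (T ^^ n) V x - v x)) \<longlonglongrightarrow> 0 \<and> (\<forall>x. (\<lambda>n. (T ^^ n) V x) \<longlonglongrightarrow> v x)"
        by blast
    qed
  qed
  ultimately show ?thesis by blast
qed

end
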